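(* Let $\mathcal{C}$ be a uniform clutter (all edges of the same cardinality) on $n$ vertices whose incidence matrix has rank $n$, and let $I\subset R=K[y_1,\ldots,y_n]$ be its edge ideal. Assume $I$ is normal, and let $\mathbb{T}=\{[(x_1,\ldots,x_n)]\in\mathbb{P}^{n-1}: x_i\in K^*\}$ be the projective torus in $\mathbb{P}^{n-1}$. Then: (a) $\deg(S/I(X))=|X|=(q-1)^{n-1}$; (b) for every $d\geq 1$, $\delta_d\leq\delta_d'$, where $\delta_d$ is the minimum distance of $C_X(d)$ and $\delta_d'$ is the minimum distance of $C_{\mathbb{T}}(d)$; (c) $\mathrm{reg}(S/I(X))\leq \mathrm{reg}(S'/I(\mathbb{T}))=(q-2)(n-1)$, where $S'=K[t_1,\ldots,t_n]$.
   Context: Let $K=\mathbb{F}_q$ be a finite field with $q\neq 2$ elements. A clutter $\mathcal{C}$ with vertex set $\{y_1,\ldots,y_n\}$ is a family of subsets (edges) of this set such that no edge is contained in another; let its edges be $f_1,\ldots,f_s$ ($s\geq 2$) with characteristic vectors $v_i=\sum_{y_j\in f_i}e_j\in\{0,1\}^n$. The incidence matrix is the $n\times s$ matrix with columns $v_1,\ldots,v_s$. The edge ideal is $I=(y^{v_1},\ldots,y^{v_s})\subset R$; $I$ is normal if $I^i=\overline{I^i}$ for all $i\geq 1$, where $\overline{I^i}$ is the ideal generated by the monomials $y^a$ with $(y^a)^p\in I^{pi}$ for some integer $p\geq 1$. For a finite set $Y=\{[P_1],\ldots,[P_m]\}\subset\mathbb{P}^{r-1}$ whose points have all coordinates nonzero,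 with $S_Y=K[t_1,\ldots,t_r]$, let $I(Y)$ be the ideal generated by homogeneous polynomials vanishing on $Y$; the code $C_Y(d)$ is the image of the $K$-linear map $(S_Y)_d\to K^m$, $f\mapsto (f(P_1)/P_{1,1}^d,\ldots,f(P_m)/P_{m,1}^d)$; its minimum distance is $\min\{\|v\|:0\neq v\in C_Y(d)\}$, $\|v\|$ being the number of nonzero entries. $H_Y(d)=\dim_K(S_Y/I(Y))_d$; $\deg(S_Y/I(Y))$ is the multiplicity, which equals the constant value of $H_Y(d)$ for $d\gg0$; $\mathrm{reg}(S_Y/I(Y))$ is the least $p\geq 0$ with $H_Y(d)=|Y|$ for all $d\geq p$. Here $X=\{[(x^{v_1},\ldots,x^{v_s})]\in\mathbb{P}^{s-1}: x\in (K^* )^n\}$ with $x^{v_i}=\prod_j x_j^{v_{ij}}$, and $S=K[t_1,\ldots,t_s]$. *)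

theory Defs
  imports Complex_Main "HOL-Library.Function_Algebras"
begin

text \<open>Vertices are 0..<n, edges are indexed 0..<s, coordinates of projective points are
indexed from 0 (index 0 plays the role of the first coordinate).\<close>

definition fscale :: "'a::field \<Rightarrow> ('b \<Rightarrow> 'a) \<Rightarrow> ('b \<Rightarrow> 'a)" where
  "fscale c g = (\<lambda>x. c * g x)"

definition fdim :: "('b \<Rightarrow> 'a::field) set \<Rightarrow> nat" where
  "fdim V = vector_space.dim (fscale :: 'a \<Rightarrow> ('b \<Rightarrow> 'a) \<Rightarrow> _) V"

text \<open>Characteristic vector of an edge (in Q^n, realised over the reals).\<close>
definition char_vec :: "nat set \<Rightarrow> nat \<Rightarrow> real" where
  "char_vec e = (\<lambda>j. if j \<in> e then 1 else 0)"

definition incidence_rank :: "nat \<Rightarrow> (nat \<Rightarrow> nat set) \<Rightarrow> nat" where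
  "incidence_rank s f = fdim {char_vec (f i) | i. i < s}"

definition is_clutter :: "nat \<Rightarrow> nat \<Rightarrow> (nat \<Rightarrow> nat set) \<Rightarrow> bool" where
  "is_clutter n s f \<longleftrightarrow> (\<forall>i<s. f i \<subseteq> {..<n}) \<and>
     (\<forall>i<s. \<forall>j<s. i \<noteq> j \<longrightarrow> \<not> f i \<subseteq> f j)"

definition uniform_clutter :: "nat \<Rightarrow> (nat \<Rightarrow> nat set) \<Rightarrow> bool" where
  "uniform_clutter s f \<longleftrightarrow> (\<forall>i<s. \<forall>j<s. card (f i) = card (f j))"

text \<open>The monomial y^a lies in the monomial ideal I^k, I = (y^{v_1},...,y^{v_s}):
  y^a is divisible by a product of k generators.\<close>
definition mono_in_power :: "nat \<Rightarrow> (nat \<Rightarrow> nat set) \<Rightarrow> nat \<Rightarrow> (nat \<Rightarrow> nat) \<Rightarrow> bool" where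
  "mono_in_power s f k a \<longleftrightarrow>
     (\<exists>m :: nat \<Rightarrow> nat. (\<Sum>i<s. m i) = k \<and>
        (\<forall>j. (\<Sum>i<s. m i * (if j \<in> f i then 1 else 0)) \<le> a j))"

text \<open>y^a lies in the integral closure of I^k: (y^a)^p \<in> I^{pk} for some p \<ge> 1.\<close>
definition mono_in_closure :: "nat \<Rightarrow> (nat \<Rightarrow> nat set) \<Rightarrow> nat \<Rightarrow> (nat \<Rightarrow> nat) \<Rightarrow> bool" where
  "mono_in_closure s f k a \<longleftrightarrow> (\<exists>p\<ge>1. mono_in_power s f (p * k) (\<lambda>j. p * a j))"

text \<open>Normality: I^i = closure(I^i) for all i \<ge> 1 (both are monomial ideals, and
  I^i \<subseteq> closure(I^i) always, so equality means every monomial of the closure lies in I^i).\<close>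
definition normal_edge_ideal :: "nat \<Rightarrow> nat \<Rightarrow> (nat \<Rightarrow> nat set) \<Rightarrow> bool" where
  "normal_edge_ideal n s f \<longleftrightarrow>
     (\<forall>i\<ge>1. \<forall>a. (\<forall>j\<ge>n. a j = 0) \<longrightarrow> mono_in_closure s f i a \<longrightarrow> mono_in_power s f i a)"

text \<open>Homogeneous polynomials of degree d in r variables t_0..t_{r-1}, as coefficient functions
  supported on the (finite) set of exponent vectors of degree d.\<close>
definition mons :: "nat \<Rightarrow> nat \<Rightarrow> (nat \<Rightarrow> nat) set" where
  "mons r d = {a. (\<forall>j\<ge>r. a j = 0) \<and> (\<Sum>j<r. a j) = d}"

definition hpolys :: "nat \<Rightarrow> nat \<Rightarrow> ((nat \<Rightarrow> nat) \<Rightarrow> 'a::field) set" where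
  "hpolys r d = {c. \<forall>a. a \<notin> mons r d \<longrightarrow> c a = 0}"

definition heval :: "nat \<Rightarrow> nat \<Rightarrow> ((nat \<Rightarrow> nat) \<Rightarrow> 'a::field) \<Rightarrow> (nat \<Rightarrow> 'a) \<Rightarrow> 'a" where
  "heval r d c P = (\<Sum>a\<in>mons r d. c a * (\<Prod>j<r. P j ^ a j))"

definition code_entry :: "nat \<Rightarrow> nat \<Rightarrow> ((nat \<Rightarrow> nat) \<Rightarrow> 'a::field) \<Rightarrow> (nat \<Rightarrow> 'a) \<Rightarrow> 'a" where
  "code_entry r d c P = heval r d c P / P 0 ^ d"

definition min_dist :: "nat \<Rightarrow> nat \<Rightarrow> (nat \<Rightarrow> 'a::field) set \<Rightarrow> nat" where
  "min_dist r d Y = Min {card {P\<in>Y. code_entry r d c P \<noteq> 0} | c.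
      c \<in> hpolys r d \<and> (\<exists>P\<in>Y. code_entry r d c P \<noteq> 0)}"

definition vanishing_part :: "nat \<Rightarrow> nat \<Rightarrow> (nat \<Rightarrow> 'a::field) set \<Rightarrow> ((nat \<Rightarrow> nat) \<Rightarrow> 'a) set" where
  "vanishing_part r d Y = {c \<in> hpolys r d. \<forall>P\<in>Y. heval r d c P = 0}"

text \<open>Hilbert function H_Y(d) = dim (S/I(Y))_d = dim S_d - dim I(Y)_d.\<close>
definition hilb :: "nat \<Rightarrow> (nat \<Rightarrow> 'a::field) set \<Rightarrow> nat \<Rightarrow> nat" where
  "hilb r Y d = fdim (hpolys r d :: ((nat \<Rightarrow> nat) \<Rightarrow> 'a) set) - fdim (vanishing_part r d Y)"

definition deg_quot :: "nat \<Rightarrow> (nat \<Rightarrow> 'a::field) set \<Rightarrow> nat" where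
  "deg_quot r Y = (THE m. \<exists>d0. \<forall>d\<ge>d0. hilb r Y d = m)"

definition reg_quot :: "nat \<Rightarrow> (nat \<Rightarrow> 'a::field) set \<Rightarrow> nat" where
  "reg_quot r Y = (LEAST p. \<forall>d\<ge>p. hilb r Y d = card Y)"

text \<open>Projective points with all coordinates nonzero are represented by their unique
  representative with first coordinate 1 (coordinates beyond the dimension are 0).\<close>
definition normalize_pt :: "(nat \<Rightarrow> 'a::field) \<Rightarrow> (nat \<Rightarrow> 'a)" where
  "normalize_pt P = (\<lambda>i. P i / P 0)"

definition torus_pts :: "nat \<Rightarrow> (nat \<Rightarrow> 'a::field) set" where
  "torus_pts n = normalize_pt ` {x. (\<forall>j<n. x j \<noteq> 0) \<and> (\<forall>j\<ge>n. x j = 0)}"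

definition clutter_pts :: "nat \<Rightarrow> nat \<Rightarrow> (nat \<Rightarrow> nat set) \<Rightarrow> (nat \<Rightarrow> 'a::field) set" where
  "clutter_pts n s f = normalize_pt `
     {(\<lambda>i. if i < s then (\<Prod>j\<in>f i. x j) else 0) | x. (\<forall>j<n. x j \<noteq> 0) \<and> (\<forall>j\<ge>n. x j = 0)}"

end

theory Submission
  imports Defs "HOL-Computational_Algebra.Polynomial" "HOL-Library.FuncSet"
begin

text \<open>
  Normality together with uniformity and full rank forces some \<open>n\<close> of the edge vectors to generate over
  \<open>\<int>\<close> all differences \<open>e\<^sub>a - e\<^sub>b\<close>: descending along a flag of facets of the edge cone, each facet keeps
  normality, its members generate all lattice points of its hyperplane, and some member lies at
  minimal lattice height above it. Projecting \<open>X\<close> to the corresponding \<open>n\<close> coordinates is therefore a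
  bijection onto the torus, along which forms of degree \<open>d\<close> pull back to forms of degree \<open>d\<close> up to a
  nowhere vanishing factor. So the code of the torus embeds into that of \<open>X\<close> preserving weights,
  which reduces everything to the torus, where the Hilbert function reaches its final value exactly
  when all monomials with exponents at most \<open>q - 2\<close> in the affine coordinates are available.
  Over a finite field the Hilbert function is read off from the cardinality \<open>q ^ hilb\<close> of the code.
\<close>

section \<open>Normal vector configurations\<close>

text \<open>A mere rational basis among the edge vectors would not do: if the index of the
  sublattice that it generates shares a factor with q - 1, distinct torus points may have the same
  projected coordinates. The index must be one, and the generators must be edges, because only edges
  are coordinates of X. Normality speaks of divisibility of monomials, not of lattices. Uniformity
  bridges the gap through degrees: a monomial of degree \<open>k * d\<close> divisible by a product
  of \<open>d\<close> edge monomials is equal to it. The resulting statement covers every integer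
  vector of the cone whose degree is a multiple of \<open>k\<close>, even one not yet known to lie
  in the lattice of the edges, and this is how the differences of unit vectors get into that
  lattice.\<close>

definition ip :: "nat \<Rightarrow> (nat \<Rightarrow> int) \<Rightarrow> (nat \<Rightarrow> int) \<Rightarrow> int" where
  "ip n g a = (\<Sum>j<n. g j * a j)"

definition zspan :: "nat \<Rightarrow> ('i \<Rightarrow> nat \<Rightarrow> int) \<Rightarrow> 'i set \<Rightarrow> (nat \<Rightarrow> int) set" where
  "zspan n v I = {a. \<exists>c. \<forall>j<n. a j = (\<Sum>i\<in>I. c i * v i j)}"

definition nspan :: "nat \<Rightarrow> ('i \<Rightarrow> nat \<Rightarrow> int) \<Rightarrow> 'i set \<Rightarrow> (nat \<Rightarrow> int) set" where
  "nspan n v I = {a. \<exists>c. (\<forall>i\<in>I. c i \<ge> 0) \<and> (\<forall>j<n. a j = (\<Sum>i\<in>I. c i * v i j))}"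

text \<open>The reference lattice is the one generated by the configuration itself: edges of size
  \<open>k\<close> never generate an integer vector whose coordinate sum is not a multiple of
  \<open>k\<close>.\<close>

definition normal_config :: "nat \<Rightarrow> ('i \<Rightarrow> nat \<Rightarrow> int) \<Rightarrow> 'i set \<Rightarrow> bool" where
  "normal_config n v I \<longleftrightarrow>
     (\<forall>a\<in>zspan n v I. \<forall>p\<ge>1. (\<lambda>j. p * a j) \<in> nspan n v I \<longrightarrow> a \<in> nspan n v I)"

lemma zspanI: "(\<And>j. j < n \<Longrightarrow> a j = (\<Sum>i\<in>I. c i * v i j)) \<Longrightarrow> a \<in> zspan n v I"
  unfolding zspan_def by blast

lemma zspanE:
  assumes "a \<in> zspan n v I"
  obtains c where "\<And>j. j < n \<Longrightarrow> a j = (\<Sum>i\<in>I. c i * v i j)"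
  using assms unfolding zspan_def by blast

lemma nspanI:
  "(\<And>i. i \<in> I \<Longrightarrow> c i \<ge> 0) \<Longrightarrow> (\<And>j. j < n \<Longrightarrow> a j = (\<Sum>i\<in>I. c i * v i j)) \<Longrightarrow> a \<in> nspan n v I"
  unfolding nspan_def by blast

lemma nspanE:
  assumes "a \<in> nspan n v I"
  obtains c where "\<And>i. i \<in> I \<Longrightarrow> c i \<ge> 0" "\<And>j. j < n \<Longrightarrow> a j = (\<Sum>i\<in>I. c i * v i j)"
  using assms unfolding nspan_def by blast

lemma nspan_subset_zspan: "nspan n v I \<subseteq> zspan n v I"
  unfolding nspan_def zspan_def by blast

lemma ip_lincomb: "ip n g (\<lambda>j. x * a j + y * b j) = x * ip n g a + y * ip n g b"
  by (simp add: ip_def sum.distrib sum_distrib_left algebra_simps)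

lemma ip_lincomb_left: "ip n (\<lambda>j. x * a j + y * b j) g = x * ip n a g + y * ip n b g"
  by (simp add: ip_def sum.distrib sum_distrib_left algebra_simps)

lemma ip_comb:
  assumes "\<And>j. j < n \<Longrightarrow> a j = (\<Sum>i\<in>I. c i * v i j)"
  shows "ip n g a = (\<Sum>i\<in>I. c i * ip n g (v i))"
proof -
  have "ip n g a = (\<Sum>j<n. \<Sum>i\<in>I. g j * (c i * v i j))"
    unfolding ip_def using assms by (simp add: sum_distrib_left)
  also have "\<dots> = (\<Sum>i\<in>I. \<Sum>j<n. g j * (c i * v i j))" by (rule sum.swap)
  also have "\<dots> = (\<Sum>i\<in>I. c i * ip n g (v i))"
    by (simp add: ip_def sum_distrib_left algebra_simps)
  finally show ?thesis .
qed

lemma zspan_lincomb: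
  assumes "a \<in> zspan n v I" "b \<in> zspan n v I"
  shows "(\<lambda>j. x * a j + y * b j) \<in> zspan n v I"
proof -
  obtain c where c: "\<And>j. j < n \<Longrightarrow> a j = (\<Sum>i\<in>I. c i * v i j)" using assms(1) by (rule zspanE) blast
  obtain d where d: "\<And>j. j < n \<Longrightarrow> b j = (\<Sum>i\<in>I. d i * v i j)" using assms(2) by (rule zspanE) blast
  show ?thesis
    by (rule zspanI[where c = "\<lambda>i. x * c i + y * d i"])
      (simp add: c d sum.distrib sum_distrib_left algebra_simps)
qed

lemma zspan_mono:
  assumes "finite I" "J \<subseteq> I"
  shows "zspan n v J \<subseteq> zspan n v I"
proof
  fix a assume "a \<in> zspan n v J"
  then obtain c where c: "\<And>j. j < n \<Longrightarrow> a j = (\<Sum>i\<in>J. c i * v i j)" by (rule zspanE) blast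
  show "a \<in> zspan n v I"
  proof (rule zspanI[where c = "\<lambda>i. if i \<in> J then c i else 0"])
    fix j assume "j < n"
    have "(\<Sum>i\<in>I. (if i \<in> J then c i else 0) * v i j) = (\<Sum>i\<in>J. c i * v i j)"
      using assms by (intro sum.mono_neutral_cong_right) auto
    with c \<open>j < n\<close> show "a j = (\<Sum>i\<in>I. (if i \<in> J then c i else 0) * v i j)" by simp
  qed
qed

lemma nspan_mono:
  assumes "finite I" "J \<subseteq> I"
  shows "nspan n v J \<subseteq> nspan n v I"
proof
  fix a assume "a \<in> nspan n v J"
  then obtain c where c: "\<And>i. i \<in> J \<Longrightarrow> c i \<ge> 0" "\<And>j. j < n \<Longrightarrow> a j = (\<Sum>i\<in>J. c i * v i j)"
    by (rule nspanE) blast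
  show "a \<in> nspan n v I"
  proof (rule nspanI[where c = "\<lambda>i. if i \<in> J then c i else 0"])
    fix j assume "j < n"
    have "(\<Sum>i\<in>I. (if i \<in> J then c i else 0) * v i j) = (\<Sum>i\<in>J. c i * v i j)"
      using assms by (intro sum.mono_neutral_cong_right) auto
    with c \<open>j < n\<close> show "a j = (\<Sum>i\<in>I. (if i \<in> J then c i else 0) * v i j)" by simp
  qed (use c in auto)
qed

lemma zspan_base: "finite I \<Longrightarrow> i \<in> I \<Longrightarrow> v i \<in> zspan n v I"
  by (rule zspanI[where c = "\<lambda>k. if k = i then 1 else 0"])
    (simp add: if_distribR if_distrib[of "(*)"] sum.delta cong: if_cong)

section \<open>Separation, facets and lattice bases of normal configurations\<close>

text \<open>Rational duality with denominators cleared: a vector outside a span is detected by a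
  functional. If the functional \<open>g\<close> obtained for \<open>I\<close> does not vanish at
  \<open>v i\<close>, the induction continues with \<open>a'\<close>, a scaled projection of
  \<open>a\<close> along \<open>v i\<close> to the kernel of \<open>g\<close>.\<close>

lemma multiple_in_zspan_or_separated:
  assumes "finite I"
  shows "(\<exists>p\<ge>1. (\<lambda>j. p * a j) \<in> zspan n v I) \<or> (\<exists>g. (\<forall>i\<in>I. ip n g (v i) = 0) \<and> ip n g a \<noteq> 0)"
  using assms
proof (induction I arbitrary: a)
  case empty
  show ?case
  proof (cases "\<forall>j<n. a j = 0")
    case True
    then have "(\<lambda>j. 1 * a j) \<in> zspan n v {}" by (intro zspanI) simp
    then show ?thesis by (intro disjI1 exI[of _ 1]) simp
  next
    case False
    then obtain j where j: "j < n" "a j \<noteq> 0" by blast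
    have "ip n (\<lambda>k. if k = j then 1 else 0) a = a j"
      using j by (simp add: ip_def if_distrib[of "\<lambda>x. x * _"] sum.delta cong: if_cong)
    with j show ?thesis by fastforce
  qed
next
  case (insert i I)
  show ?case
  proof (cases "\<exists>p\<ge>1. (\<lambda>j. p * a j) \<in> zspan n v I")
    case True
    then show ?thesis using zspan_mono[of "insert i I" I n v] insert.hyps by blast
  next
    case False
    with insert.IH[of a] obtain g where g: "\<forall>k\<in>I. ip n g (v k) = 0" "ip n g a \<noteq> 0" by blast
    show ?thesis
    proof (cases "ip n g (v i) = 0")
      case True
      with g show ?thesis by blast
    next
      case gi: False
      define \<alpha> where "\<alpha> = ip n g (v i)"
      define a' where "a' = (\<lambda>j. \<alpha> * a j + (- ip n g a) * v i j)"
      from insert.IH[of a'] show ?thesis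
      proof
        assume "\<exists>p\<ge>1. (\<lambda>j. p * a' j) \<in> zspan n v I"
        then obtain p where p: "p \<ge> 1" "(\<lambda>j. p * a' j) \<in> zspan n v (insert i I)"
          using zspan_mono[of "insert i I" I n v] insert.hyps by blast
        have "v i \<in> zspan n v (insert i I)" using insert.hyps by (intro zspan_base) auto
        \<comment> \<open>The factor \<open>sgn \<alpha>\<close> turns the multiplier
          \<open>p * \<alpha>\<close> of \<open>a\<close> into
          \<open>p * \<bar>\<alpha>\<bar>\<close>, which is at least 1.\<close>
        from zspan_lincomb[OF p(2) this, of "sgn \<alpha>" "sgn \<alpha> * p * ip n g a"]
        have "(\<lambda>j. (p * \<bar>\<alpha>\<bar>) * a j) \<in> zspan n v (insert i I)"
          by (simp add: a'_def algebra_simps abs_sgn)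
        moreover have "p * \<bar>\<alpha>\<bar> \<ge> 1" using p(1) gi by (simp add: \<alpha>_def int_one_le_iff_zero_less)
        ultimately show ?thesis by blast
      next
        assume "\<exists>g. (\<forall>i\<in>I. ip n g (v i) = 0) \<and> ip n g a' \<noteq> 0"
        then obtain g' where g': "\<forall>k\<in>I. ip n g' (v k) = 0" "ip n g' a' \<noteq> 0" by blast
        \<comment> \<open>The multiple of \<open>g\<close> cancels the value of \<open>g'\<close> at
          \<open>v i\<close>; on \<open>a\<close> the value becomes
          \<open>ip n g' a'\<close>.\<close>
        define h where "h = (\<lambda>j. \<alpha> * g' j + (- ip n g' (v i)) * g j)"
        have "\<forall>k\<in>insert i I. ip n h (v k) = 0"
          unfolding h_def ip_lincomb_left using g g' by (simp add: \<alpha>_def)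
        moreover have "ip n h a = ip n g' a'"
          unfolding h_def a'_def ip_lincomb_left ip_lincomb by simp
        ultimately show ?thesis using g' by metis
      qed
    qed
  qed
qed

text \<open>A functional that is nonnegative on the configuration and vanishes on as many of its members
  as possible defines a facet of the cone. Otherwise it could be tilted until it also vanishes
  on a further member.\<close>

lemma facet_functional_exists:
  assumes fin: "finite I" and w0: "w0 \<in> I" and pos: "\<And>i. i \<in> I \<Longrightarrow> ip n g0 (v i) > 0"
  obtains h w where "\<And>i. i \<in> I \<Longrightarrow> ip n h (v i) \<ge> 0" "w \<in> I" "ip n h (v w) > 0"
    "\<And>g i. (\<And>k. k \<in> I \<Longrightarrow> ip n h (v k) = 0 \<Longrightarrow> ip n g (v k) = 0) \<Longrightarrow> i \<in> I \<Longrightarrow>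
       ip n h (v w) * ip n g (v i) = ip n g (v w) * ip n h (v i)"
proof -
  define Q where "Q h \<longleftrightarrow> (\<forall>i\<in>I. ip n h (v i) \<ge> 0) \<and> (\<exists>w\<in>I. ip n h (v w) > 0)" for h
  define N where "N h = card {i\<in>I. ip n h (v i) = 0}" for h
  have "Q g0" using pos w0 by (force simp: Q_def)
  moreover have "N h < Suc (card I)" for h
    unfolding N_def using card_mono[OF fin, of "{i\<in>I. ip n h (v i) = 0}"] by auto
  ultimately obtain h where h: "Q h" and max: "\<And>h'. Q h' \<Longrightarrow> N h' \<le> N h"
    using ex_has_greatest_nat[of Q g0 N "Suc (card I)"] by (metis less_imp_le)
  from h have h0: "\<And>i. i \<in> I \<Longrightarrow> ip n h (v i) \<ge> 0" by (simp add: Q_def)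
  from h obtain w where w: "w \<in> I" "ip n h (v w) > 0" by (auto simp: Q_def)
  have no_neg: False
    if g: "\<And>k. k \<in> I \<Longrightarrow> ip n h (v k) = 0 \<Longrightarrow> ip n g (v k) = 0" "ip n g (v w) = 0"
      and i: "i \<in> I" "ip n g (v i) < 0" for g i
  proof -
    define J where "J = {i\<in>I. ip n g (v i) < 0}"
    define r where "r i = real_of_int (ip n h (v i)) / real_of_int (- ip n g (v i))" for i
    have J: "finite J" "J \<noteq> {}" using fin i by (auto simp: J_def)
    obtain i0 where i0: "i0 \<in> J" "\<And>k. k \<in> J \<Longrightarrow> r i0 \<le> r k"
      using arg_min_if_finite(1)[OF J, of r] arg_min_least[OF J, of _ r] by blast
    have gi0: "i0 \<in> I" "ip n g (v i0) < 0" using i0 by (auto simp: J_def)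
    \<comment> \<open>Ratio test: \<open>i0\<close> minimises the quotient of \<open>h\<close> by
      \<open>-g\<close> over the members with negative \<open>g\<close>, so tilting \<open>h\<close>
      until \<open>i0\<close> has height 0 keeps all heights nonnegative. The height of
      \<open>w\<close> stays positive because \<open>g\<close> vanishes there.\<close>
    define h' where "h' = (\<lambda>j. (- ip n g (v i0)) * h j + ip n h (v i0) * g j)"
    have h'_ip: "ip n h' (v k) = (- ip n g (v i0)) * ip n h (v k) + ip n h (v i0) * ip n g (v k)" for k
      unfolding h'_def ip_lincomb_left ..
    have "ip n h' (v k) \<ge> 0" if k: "k \<in> I" for k
    proof (cases "ip n g (v k) < 0")
      case True
      then have "r i0 \<le> r k" using i0 k by (auto simp: J_def)
      then have "real_of_int (ip n h (v i0)) * real_of_int (- ip n g (v k))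
          \<le> real_of_int (ip n h (v k)) * real_of_int (- ip n g (v i0))"
        unfolding r_def using True gi0 by (simp add: divide_simps mult.commute)
      then have "ip n h (v i0) * (- ip n g (v k)) \<le> ip n h (v k) * (- ip n g (v i0))"
        by (metis of_int_le_iff of_int_mult)
      then show ?thesis unfolding h'_ip by (simp add: algebra_simps)
    next
      case False
      then show ?thesis unfolding h'_ip using h0[OF k] h0[OF gi0(1)] gi0(2)
        by (intro add_nonneg_nonneg mult_nonneg_nonneg) auto
    qed
    moreover have "ip n h' (v w) > 0" unfolding h'_ip using g(2) w gi0 by (simp add: mult_neg_pos)
    ultimately have "Q h'" unfolding Q_def using w by blast
    moreover have "{k\<in>I. ip n h (v k) = 0} \<subset> {k\<in>I. ip n h' (v k) = 0}"
    proof
      show "{k\<in>I. ip n h (v k) = 0} \<subseteq> {k\<in>I. ip n h' (v k) = 0}" using g h'_ip by auto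
      have "ip n h' (v i0) = 0" unfolding h'_ip by simp
      moreover have "ip n h (v i0) \<noteq> 0" using g(1) gi0 by force
      ultimately show "{k\<in>I. ip n h (v k) = 0} \<noteq> {k\<in>I. ip n h' (v k) = 0}" using gi0 by blast
    qed
    then have "N h < N h'" unfolding N_def using fin by (intro psubset_card_mono) auto
    ultimately show False using max by (metis not_le)
  qed
  have "ip n h (v w) * ip n g (v i) = ip n g (v w) * ip n h (v i)"
    if g: "\<And>k. k \<in> I \<Longrightarrow> ip n h (v k) = 0 \<Longrightarrow> ip n g (v k) = 0" and i: "i \<in> I" for g i
  proof (rule ccontr)
    assume ne: "\<not> ?thesis"
    \<comment> \<open>\<open>g' 1\<close> and \<open>g' (-1)\<close> are opposite functionals
      vanishing at \<open>w\<close> and wherever \<open>h\<close> does on \<open>I\<close>;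
      \<open>no_neg\<close> applied to both leaves only the value 0 at \<open>i\<close>.\<close>
    define g' where "g' t = (\<lambda>j. (t * ip n h (v w)) * g j + (- t * ip n g (v w)) * h j)" for t
    have g': "ip n (g' t) (v k) = t * (ip n h (v w) * ip n g (v k) - ip n g (v w) * ip n h (v k))" for t k
      unfolding g'_def ip_lincomb_left by (simp add: algebra_simps)
    have nn: "\<not> ip n (g' t) (v i) < 0" for t
      using no_neg[of "g' t" i] g i by (auto simp: g')
    from nn[of 1] nn[of "-1"] ne show False by (simp add: g')
  qed
  with that[OF h0 w] show ?thesis by blast
qed

text \<open>Adding \<open>N\<close> times the sum of the generators to a vector \<open>a\<close>
  raises each coefficient of \<open>p * a\<close> by \<open>p * N\<close>; one common
  \<open>N\<close> thus moves \<open>a\<close> into the cone.\<close>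

lemma finite_shift_nonneg:
  fixes c :: "'i \<Rightarrow> int"
  assumes "finite I" "p \<ge> 1"
  obtains N where "\<And>i. i \<in> I \<Longrightarrow> c i + p * N \<ge> 0"
proof
  fix i assume i: "i \<in> I"
  define N where "N = (\<Sum>k\<in>I. \<bar>c k\<bar>)"
  have "\<bar>c i\<bar> \<le> N" unfolding N_def using assms i by (intro member_le_sum) auto
  moreover have "N \<le> p * N" using assms mult_right_mono[of 1 p N] by (simp add: N_def sum_nonneg)
  ultimately show "c i + p * (\<Sum>k\<in>I. \<bar>c k\<bar>) \<ge> 0" unfolding N_def by linarith
qed

text \<open>By induction along a facet: the members on the facet generate the lattice points
  of its hyperplane, and normality provides a member at minimal lattice height above it.\<close>

lemma normal_config_basis:
  assumes "finite I" "normal_config n v I" "\<And>i. i \<in> I \<Longrightarrow> ip n g0 (v i) > 0"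
  shows "\<exists>B\<subseteq>I. zspan n v I \<subseteq> zspan n v B \<and>
    (\<forall>c. (\<forall>j<n. (\<Sum>i\<in>B. c i * v i j) = 0) \<longrightarrow> (\<forall>i\<in>B. c i = 0))"
  using assms
proof (induction I rule: finite_psubset_induct)
  case (psubset I)
  note normal = psubset.prems(1)[unfolded normal_config_def, rule_format]
  show ?case
  proof (cases "I = {}")
    case True
    then show ?thesis by auto
  next
    case False
    then obtain w0 where "w0 \<in> I" by blast
    then obtain h w where
      h0: "\<And>i. i \<in> I \<Longrightarrow> ip n h (v i) \<ge> 0" and w: "w \<in> I" "ip n h (v w) > 0" and
      facet: "\<And>g i. (\<And>k. k \<in> I \<Longrightarrow> ip n h (v k) = 0 \<Longrightarrow> ip n g (v k) = 0) \<Longrightarrow> i \<in> I \<Longrightarrow>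
         ip n h (v w) * ip n g (v i) = ip n g (v w) * ip n h (v i)"
      using facet_functional_exists[of I w0 n g0 v] psubset.hyps(1) psubset.prems(2) by metis
    define F where "F = {i\<in>I. ip n h (v i) = 0}"
    have wF: "w \<notin> F" using w by (simp add: F_def)
    have FI: "F \<subseteq> I" by (auto simp: F_def)
    with w wF have F: "F \<subset> I" "finite F" "F \<subseteq> I" using psubset.hyps(1) finite_subset by blast+
    have zF: "ip n h a = 0" if a: "a \<in> zspan n v F" for a
    proof -
      obtain c where "\<And>j. j < n \<Longrightarrow> a j = (\<Sum>i\<in>F. c i * v i j)" using a by (rule zspanE) blast
      from ip_comb[OF this] show ?thesis by (simp add: F_def)
    qed
    \<comment> \<open>Heights are nonnegative, so a nonnegative combination of height 0 only uses
      members of \<open>F\<close>.\<close>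
    have face: "a \<in> nspan n v F" if a: "a \<in> nspan n v I" "ip n h a = 0" for a
    proof -
      obtain c where c: "\<And>i. i \<in> I \<Longrightarrow> c i \<ge> 0" "\<And>j. j < n \<Longrightarrow> a j = (\<Sum>i\<in>I. c i * v i j)"
        using a(1) by (rule nspanE) blast
      have "(\<Sum>i\<in>I. c i * ip n h (v i)) = 0" using ip_comb[OF c(2)] a(2) by simp
      then have "\<forall>i\<in>I. c i * ip n h (v i) = 0"
        using c(1) h0 psubset.hyps(1) by (subst (asm) sum_nonneg_eq_0_iff) auto
      then have z: "c i = 0" if "i \<in> I - F" for i using that by (auto simp: F_def)
      have "(\<Sum>i\<in>I. c i * v i j) = (\<Sum>i\<in>F. c i * v i j)" for j
        using F psubset.hyps(1) z by (intro sum.mono_neutral_right) auto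
      with c F show ?thesis by (intro nspanI[where c = c]) auto
    qed
    \<comment> \<open>By \<open>eq\<close>, \<open>a\<close> is \<open>t / p\<close> times
      \<open>v w\<close> plus a rational combination of \<open>F\<close>. Adding the sum of
      \<open>F\<close> often enough makes all coefficients nonnegative, and normality then yields a
      semigroup element of the same height as \<open>a\<close>.\<close>
    have absorb: "\<exists>N. (\<lambda>j. a j + N * (\<Sum>i\<in>F. v i j)) \<in> nspan n v I"
      if a: "a \<in> zspan n v I" and p: "p \<ge> 1" and t: "t \<ge> 0"
        and eq: "(\<lambda>j. p * a j - t * v w j) \<in> zspan n v F" for a p t
    proof -
      obtain c where c: "\<And>j. j < n \<Longrightarrow> p * a j - t * v w j = (\<Sum>i\<in>F. c i * v i j)"
        using eq by (rule zspanE) blast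
      obtain N where N: "\<And>i. i \<in> F \<Longrightarrow> c i + p * N \<ge> 0"
        using finite_shift_nonneg[OF F(2) p] by metis
      have sF: "(\<lambda>j. \<Sum>i\<in>F. v i j) \<in> zspan n v I"
        using zspan_mono[OF psubset.hyps(1) F(3)] zspanI[where c = "\<lambda>_. 1" and I = F] by fastforce
      define a' where "a' = (\<lambda>j. a j + N * (\<Sum>i\<in>F. v i j))"
      have a': "a' \<in> zspan n v I" using zspan_lincomb[OF a sF, of 1 N] by (simp add: a'_def)
      have "(\<lambda>j. p * a' j) \<in> nspan n v (insert w F)"
      proof (rule nspanI[where c = "\<lambda>i. if i = w then t else c i + p * N"])
        fix j assume j: "j < n"
        have "(\<Sum>i\<in>F. (if i = w then t else c i + p * N) * v i j) = (\<Sum>i\<in>F. (c i + p * N) * v i j)"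
          using wF by (intro sum.cong) auto
        then show "p * a' j = (\<Sum>i\<in>insert w F. (if i = w then t else c i + p * N) * v i j)"
          using c[OF j] wF F(2)
          by (simp add: a'_def algebra_simps sum.distrib sum_distrib_left)
      qed (use N t in auto)
      then have "(\<lambda>j. p * a' j) \<in> nspan n v I"
        using nspan_mono[OF psubset.hyps(1), of "insert w F"] F w by blast
      then show ?thesis using normal[OF a' p] unfolding a'_def by blast
    qed
    have hsum: "ip n h (\<lambda>j. a j + N * (\<Sum>i\<in>F. v i j)) = ip n h a" for a N
    proof -
      have "ip n h (\<lambda>j. \<Sum>i\<in>F. v i j) = 0"
        by (rule zF, rule zspanI[where c = "\<lambda>_. 1"]) simp
      then show ?thesis using ip_lincomb[of n h 1 a N] by simp
    qed
    have lat: "a \<in> zspan n v F" if a: "a \<in> zspan n v I" "ip n h a = 0" for a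
    proof -
      have "\<exists>p\<ge>1. (\<lambda>j. p * a j) \<in> zspan n v F"
      proof (rule ccontr)
        assume "\<not> ?thesis"
        with multiple_in_zspan_or_separated[OF F(2), of a n v] obtain g where
          g: "\<forall>i\<in>F. ip n g (v i) = 0" "ip n g a \<noteq> 0" by blast
        obtain c where c: "\<And>j. j < n \<Longrightarrow> a j = (\<Sum>i\<in>I. c i * v i j)" using a(1) by (rule zspanE) blast
        \<comment> \<open>By the facet property a separating \<open>g\<close> is proportional to
          \<open>h\<close> on all of \<open>I\<close>, so it vanishes at \<open>a\<close> together
          with \<open>h\<close>.\<close>
        have "ip n h (v w) * ip n g a = (\<Sum>i\<in>I. c i * (ip n h (v w) * ip n g (v i)))"
          using ip_comb[OF c] by (simp add: sum_distrib_left algebra_simps)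
        also have "\<dots> = (\<Sum>i\<in>I. c i * (ip n g (v w) * ip n h (v i)))"
          using facet[of g] g by (intro sum.cong) (auto simp: F_def)
        also have "\<dots> = ip n g (v w) * ip n h a"
          using ip_comb[OF c] by (simp add: sum_distrib_left algebra_simps)
        finally show False using a g w by simp
      qed
      then obtain p where p: "p \<ge> 1" "(\<lambda>j. p * a j) \<in> zspan n v F" by blast
      from absorb[OF a(1) p(1), of 0] p(2) obtain N where
        N: "(\<lambda>j. a j + N * (\<Sum>i\<in>F. v i j)) \<in> nspan n v I" by auto
      have 1: "(\<lambda>j. a j + N * (\<Sum>i\<in>F. v i j)) \<in> zspan n v F"
        using face[OF N] hsum a(2) subsetD[OF nspan_subset_zspan] by simp
      have 2: "(\<lambda>j. \<Sum>i\<in>F. v i j) \<in> zspan n v F" by (rule zspanI[where c = "\<lambda>_. 1"]) simp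
      from zspan_lincomb[OF 1 2, of 1 "-N"] show ?thesis by simp
    qed
    \<comment> \<open>Positive heights attained on the lattice; by division with remainder the least
      one divides all others.\<close>
    define H where "H m \<longleftrightarrow> m > 0 \<and> (\<exists>a\<in>zspan n v I. ip n h a = int m)" for m
    have vI: "v i \<in> zspan n v I" if "i \<in> I" for i using that psubset.hyps(1) by (intro zspan_base)
    have "H (nat (ip n h (v w)))" using w vI by (auto simp: H_def)
    then have Hm: "H (Least H)" by (rule LeastI)
    define m where "m = int (Least H)"
    from Hm obtain a where a: "a \<in> zspan n v I" "ip n h a = m" and m: "m > 0"
      by (auto simp: H_def m_def)
    have least: "m \<le> ip n h b" if "b \<in> zspan n v I" "ip n h b > 0" for b
    proof -
      have "H (nat (ip n h b))" using that by (auto simp: H_def)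
      then have "Least H \<le> nat (ip n h b)" by (rule Least_le)
      then show ?thesis using that by (simp add: m_def)
    qed
    have dvd: "m dvd ip n h b" if b: "b \<in> zspan n v I" for b
    proof -
      have 1: "(\<lambda>j. 1 * b j + (- (ip n h b div m)) * a j) \<in> zspan n v I"
        by (rule zspan_lincomb[OF b a(1)])
      have 2: "ip n h (\<lambda>j. 1 * b j + (- (ip n h b div m)) * a j) = ip n h b mod m"
        unfolding ip_lincomb a(2) by (simp add: minus_div_mult_eq_mod)
      have "0 \<le> ip n h b mod m" "ip n h b mod m < m" using m by auto
      with least[OF 1] 2 show ?thesis by fastforce
    qed
    \<comment> \<open>The vector \<open>ip n h (v w) * a - m * v w\<close> has height 0, so
      \<open>absorb\<close> moves \<open>a\<close> into the semigroup at height \<open>m\<close>.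
      Some summand there has positive height, and minimality of \<open>m\<close> forces its
      generator to have height exactly \<open>m\<close>.\<close>
    obtain u where u: "u \<in> I" "ip n h (v u) = m"
    proof -
      have 1: "(\<lambda>j. ip n h (v w) * a j + (- m) * v w j) \<in> zspan n v I"
        by (rule zspan_lincomb[OF a(1) vI[OF w(1)]])
      have 2: "ip n h (\<lambda>j. ip n h (v w) * a j + (- m) * v w j) = 0"
        unfolding ip_lincomb a(2) by simp
      have "\<exists>N. (\<lambda>j. a j + N * (\<Sum>i\<in>F. v i j)) \<in> nspan n v I"
        by (rule absorb[OF a(1), of "ip n h (v w)" m]) (use w m lat[OF 1 2] in auto)
      then obtain N where N: "(\<lambda>j. a j + N * (\<Sum>i\<in>F. v i j)) \<in> nspan n v I" ..
      then obtain c where c: "\<And>i. i \<in> I \<Longrightarrow> c i \<ge> 0"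
        "\<And>j. j < n \<Longrightarrow> a j + N * (\<Sum>i\<in>F. v i j) = (\<Sum>i\<in>I. c i * v i j)"
        by (rule nspanE) blast
      have "ip n h (\<lambda>j. a j + N * (\<Sum>i\<in>F. v i j)) = (\<Sum>i\<in>I. c i * ip n h (v i))"
        by (rule ip_comb) (rule c(2))
      then have s: "(\<Sum>i\<in>I. c i * ip n h (v i)) = m" using hsum a(2) by simp
      have "\<exists>u\<in>I. c u * ip n h (v u) \<noteq> 0"
      proof (rule ccontr)
        assume "\<not> ?thesis"
        then have "(\<Sum>i\<in>I. c i * ip n h (v i)) = 0" by (intro sum.neutral) blast
        with s m show False by simp
      qed
      then obtain u where u: "u \<in> I" "c u * ip n h (v u) \<noteq> 0" by blast
      then have cu: "c u \<ge> 1" "ip n h (v u) > 0" using c(1)[of u] h0[of u] by auto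
      have "c u * ip n h (v u) \<le> m" unfolding s[symmetric]
        using psubset.hyps(1) u c(1) h0 by (intro member_le_sum) auto
      moreover have "ip n h (v u) \<le> c u * ip n h (v u)" using cu by simp
      ultimately have "ip n h (v u) = m" using least[OF vI[OF u(1)] cu(2)] by linarith
      with u that show ?thesis by blast
    qed
    have "normal_config n v F" unfolding normal_config_def
    proof (intro ballI allI impI)
      fix b p assume b: "b \<in> zspan n v F" "(1::int) \<le> p" "(\<lambda>j. p * b j) \<in> nspan n v F"
      then have "b \<in> zspan n v I" "(\<lambda>j. p * b j) \<in> nspan n v I"
        using zspan_mono[OF psubset.hyps(1) F(3)] nspan_mono[OF psubset.hyps(1) F(3)] by blast+
      with normal b(2) face zF b(1) show "b \<in> nspan n v F" by blast
    qed
    from psubset.IH[OF F(1) this] psubset.prems(2) F(3) obtain B where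
      B: "B \<subseteq> F" "zspan n v F \<subseteq> zspan n v B"
        "\<And>c. (\<forall>j<n. (\<Sum>i\<in>B. c i * v i j) = 0) \<Longrightarrow> (\<forall>i\<in>B. c i = 0)" by blast
    have "u \<notin> F" using u m by (simp add: F_def)
    with B(1) F(2) have uB: "u \<notin> B" "finite B" using finite_subset by blast+
    show ?thesis
    proof (intro exI[of _ "insert u B"] conjI allI impI)
      show "insert u B \<subseteq> I" using u B F by auto
      show "zspan n v I \<subseteq> zspan n v (insert u B)"
      proof
        fix b assume b: "b \<in> zspan n v I"
        define t where "t = ip n h b div m"
        have 1: "(\<lambda>j. 1 * b j + (- t) * v u j) \<in> zspan n v I"
          by (rule zspan_lincomb[OF b vI[OF u(1)]])
        have 2: "ip n h (\<lambda>j. 1 * b j + (- t) * v u j) = 0"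
          unfolding ip_lincomb u(2) t_def using dvd[OF b] by simp
        have 3: "(\<lambda>j. 1 * b j + (- t) * v u j) \<in> zspan n v (insert u B)"
          using lat[OF 1 2] B(2) zspan_mono[of "insert u B" B n v] uB by blast
        have 4: "v u \<in> zspan n v (insert u B)" using uB by (intro zspan_base) auto
        from zspan_lincomb[OF 3 4, of 1 t] show "b \<in> zspan n v (insert u B)" by simp
      qed
      fix c assume c: "\<forall>j<n. (\<Sum>i\<in>insert u B. c i * v i j) = 0"
      \<comment> \<open>Applying \<open>h\<close> to a relation removes \<open>B\<close>, which lies
        on the facet, and isolates the coefficient of \<open>u\<close>.\<close>
      have "ip n h (\<lambda>_. 0) = (\<Sum>i\<in>insert u B. c i * ip n h (v i))"
        by (rule ip_comb) (use c in simp)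
      moreover have "ip n h (\<lambda>_. 0) = 0" by (simp add: ip_def)
      moreover have "(\<Sum>i\<in>B. c i * ip n h (v i)) = 0"
        using B(1) by (intro sum.neutral) (auto simp: F_def)
      ultimately have "c u = 0" using uB u m by simp
      with c B(3)[of c] uB show "\<forall>i\<in>insert u B. c i = 0" by simp
    qed
  qed
qed

lemma dependent_if_card_gt:
  fixes v :: "'i \<Rightarrow> nat \<Rightarrow> int"
  assumes "finite B" "card B > n"
  shows "\<exists>c. (\<forall>j<n. (\<Sum>i\<in>B. c i * v i j) = 0) \<and> (\<exists>i\<in>B. c i \<noteq> 0)"
  using assms
proof (induction n arbitrary: v B)
  case 0
  then have "B \<noteq> {}" by auto
  then show ?case by (intro exI[of _ "\<lambda>_. 1"]) auto
next
  case (Suc n)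
  show ?case
  proof (cases "\<forall>i\<in>B. v i n = 0")
    case True
    from Suc.IH[of B v] Suc.prems obtain c where
      c: "\<forall>j<n. (\<Sum>i\<in>B. c i * v i j) = 0" "\<exists>i\<in>B. c i \<noteq> 0" by auto
    then show ?thesis using True by (intro exI[of _ c]) (auto simp: less_Suc_eq)
  next
    case False
    then obtain u where u: "u \<in> B" "v u n \<noteq> 0" by blast
    \<comment> \<open>Division-free elimination of the last coordinate with pivot
      \<open>v u n\<close>; \<open>d\<close> below carries a relation among the \<open>w i\<close>
      back to the \<open>v i\<close>.\<close>
    define w where "w i j = v u n * v i j - v i n * v u j" for i j
    have "finite (B - {u})" "card (B - {u}) > n" using Suc.prems u by auto
    from Suc.IH[OF this, of w] obtain c where
      c: "\<forall>j<n. (\<Sum>i\<in>B - {u}. c i * w i j) = 0" "\<exists>i\<in>B - {u}. c i \<noteq> 0" by blast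
    have c': "(\<Sum>i\<in>B - {u}. c i * w i j) = 0" if "j < Suc n" for j
      using that c(1) by (cases "j = n") (auto simp: w_def)
    define d where "d i = (if i = u then - (\<Sum>i\<in>B - {u}. c i * v i n) else v u n * c i)" for i
    have "(\<Sum>i\<in>B. d i * v i j) = (\<Sum>i\<in>B - {u}. c i * w i j)" for j
    proof -
      have "(\<Sum>i\<in>B. d i * v i j) = d u * v u j + (\<Sum>i\<in>B - {u}. d i * v i j)"
        using Suc.prems u by (intro sum.remove)
      also have "(\<Sum>i\<in>B - {u}. d i * v i j) = (\<Sum>i\<in>B - {u}. v u n * c i * v i j)"
        by (intro sum.cong) (auto simp: d_def)
      also have "d u * v u j + \<dots> = (\<Sum>i\<in>B - {u}. c i * w i j)"
        by (simp add: d_def w_def sum_distrib_left sum_subtractf algebra_simps)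
      finally show ?thesis .
    qed
    moreover have "\<exists>i\<in>B. d i \<noteq> 0" using c(2) u by (auto simp: d_def)
    ultimately show ?thesis using c' by (intro exI[of _ d]) auto
  qed
qed

section \<open>Hilbert functions over finite fields and the torus\<close>

interpretation fvs: vector_space "fscale :: 'a::field \<Rightarrow> ('b \<Rightarrow> 'a) \<Rightarrow> 'b \<Rightarrow> 'a"
  by unfold_locales (auto simp: fscale_def fun_eq_iff algebra_simps)

lemma card_field_gt_1: "card (UNIV :: 'a::{finite,field} set) > 1"
proof -
  have "card {0, 1 :: 'a} \<le> card (UNIV :: 'a set)" by (intro card_mono) auto
  then show ?thesis by simp
qed

text \<open>The new span is the disjoint union of the translates of the old one by the q multiples
  of \<open>b\<close>.\<close>

lemma card_span_independent:
  fixes B :: "('b \<Rightarrow> 'a::{finite,field}) set"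
  assumes "finite B" "fvs.independent B"
  shows "card (fvs.span B) = card (UNIV :: 'a set) ^ card B"
  using assms
proof (induction B rule: finite_induct)
  case empty
  then show ?case by simp
next
  case (insert b B)
  then have b: "b \<notin> fvs.span B" "fvs.independent B" by (auto simp: fvs.independent_insert)
  have "bij_betw (\<lambda>(k, x). fscale k b + x) (UNIV \<times> fvs.span B) (fvs.span (insert b B))"
    unfolding bij_betw_def
  proof
    show "inj_on (\<lambda>(k, x). fscale k b + x) (UNIV \<times> fvs.span B)"
    proof (rule inj_onI, clarify)
      fix k k' x x'
      assume x: "x \<in> fvs.span B" "x' \<in> fvs.span B" and eq: "fscale k b + x = fscale k' b + x'"
      have "fscale (k - k') b = x' - x" using eq by (simp add: fvs.scale_left_diff_distrib algebra_simps)
      then have *: "fscale (k - k') b \<in> fvs.span B" using x by (simp add: fvs.span_diff)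
      have "k = k'"
      proof (rule ccontr)
        assume "k \<noteq> k'"
        then have "b = fscale (1 / (k - k')) (fscale (k - k') b)" by simp
        then show False using b(1) fvs.span_scale[OF *] by metis
      qed
      with eq show "k = k' \<and> x = x'" by simp
    qed
    show "(\<lambda>(k, x). fscale k b + x) ` (UNIV \<times> fvs.span B) = fvs.span (insert b B)"
    proof
      show "(\<lambda>(k, x). fscale k b + x) ` (UNIV \<times> fvs.span B) \<subseteq> fvs.span (insert b B)"
        using fvs.span_mono[of B "insert b B"]
        by (auto intro!: fvs.span_add fvs.span_scale intro: fvs.span_base)
      show "fvs.span (insert b B) \<subseteq> (\<lambda>(k, x). fscale k b + x) ` (UNIV \<times> fvs.span B)"
      proof
        fix y assume "y \<in> fvs.span (insert b B)"
        then obtain k where "y - fscale k b \<in> fvs.span B" by (auto simp: fvs.span_breakdown_eq)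
        then show "y \<in> (\<lambda>(k, x). fscale k b + x) ` (UNIV \<times> fvs.span B)"
          by (intro image_eqI[of _ _ "(k, y - fscale k b)"]) auto
      qed
    qed
  qed
  from bij_betw_same_card[OF this] show ?case
    using insert b by (simp add: card_cartesian_product)
qed

lemma card_eq_power_fdim:
  fixes V :: "('b \<Rightarrow> 'a::{finite,field}) set"
  assumes "fvs.subspace V" "finite V"
  shows "card V = card (UNIV :: 'a set) ^ fdim V"
proof -
  obtain B where B: "B \<subseteq> V" "fvs.independent B" "V \<subseteq> fvs.span B" "card B = fvs.dim V"
    by (rule fvs.basis_exists)
  have "V = fvs.span B" using B assms fvs.span_minimal by blast
  moreover have "finite B" using B assms finite_subset by blast
  ultimately show ?thesis using card_span_independent[of B] B by (simp add: fdim_def)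
qed

definition supported :: "'b set \<Rightarrow> ('b \<Rightarrow> 'a::field) set" where
  "supported A = {F. \<forall>x. x \<notin> A \<longrightarrow> F x = 0}"

lemma card_supported:
  assumes "finite A"
  shows "card (supported A :: ('b \<Rightarrow> 'a::{finite,field}) set) = card (UNIV :: 'a set) ^ card A"
proof -
  have "bij_betw (\<lambda>F. restrict F A) (supported A :: ('b \<Rightarrow> 'a) set) (A \<rightarrow>\<^sub>E UNIV)"
    by (rule bij_betw_byWitness[where f' = "\<lambda>G x. if x \<in> A then G x else 0"])
      (auto simp: supported_def fun_eq_iff PiE_def extensional_def)
  from bij_betw_same_card[OF this] assms show ?thesis by (simp add: card_funcsetE)
qed

lemma finite_supported:
  assumes "finite A"
  shows "finite (supported A :: ('b \<Rightarrow> 'a::{finite,field}) set)"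
  using card_supported[OF assms, where 'a = 'a] card_field_gt_1[where 'a = 'a]
  by (intro card_ge_0_finite) simp

lemma finite_mons: "finite (mons r d)"
proof (rule finite_subset)
  show "mons r d \<subseteq> {a. \<forall>j. (j \<in> {..<r} \<longrightarrow> a j \<in> {..d}) \<and> (j \<notin> {..<r} \<longrightarrow> a j = 0)}"
    by (auto simp: mons_def intro: member_le_sum[where A = "{..<r}" and 'b = nat])
  show "finite {a. \<forall>j. (j \<in> {..<r} \<longrightarrow> a j \<in> {..d}) \<and> (j \<notin> {..<r} \<longrightarrow> a j = (0::nat))}"
    by (rule finite_set_of_finite_funs) auto
qed

lemma hpolys_eq_supported: "hpolys r d = supported (mons r d)"
  by (simp add: hpolys_def supported_def)

text \<open>The code of \<open>Y\<close>, extended by 0 and without the division by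
  \<open>P 0 ^ d\<close>, which changes nothing at points with first coordinate 1.\<close>

definition evals :: "nat \<Rightarrow> nat \<Rightarrow> (nat \<Rightarrow> 'a::field) set \<Rightarrow> ((nat \<Rightarrow> 'a) \<Rightarrow> 'a) set" where
  "evals r d Y = (\<lambda>c P. if P \<in> Y then heval r d c P else 0) ` hpolys r d"

lemma heval_add: "heval r d (c + c') P = heval r d c P + heval r d c' P"
  by (simp add: heval_def sum.distrib algebra_simps)

lemma heval_diff: "heval r d (c - c') P = heval r d c P - heval r d c' P"
  by (simp add: heval_def sum_subtractf algebra_simps)

lemma heval_fscale: "heval r d (fscale k c) P = k * heval r d c P"
  by (simp add: heval_def fscale_def sum_distrib_left algebra_simps)

lemma heval_homogeneous: "heval r d c (\<lambda>j. t * P j) = t ^ d * heval r d c P"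
  unfolding heval_def sum_distrib_left
proof (rule sum.cong[OF refl])
  fix a assume "a \<in> mons r d"
  then have "(\<Prod>j<r. t ^ a j) = t ^ d" by (simp add: mons_def flip: power_sum)
  then show "c a * (\<Prod>j<r. (t * P j) ^ a j) = t ^ d * (c a * (\<Prod>j<r. P j ^ a j))"
    by (simp add: power_mult_distrib prod.distrib algebra_simps)
qed

lemma heval_cong: "(\<And>j. j < r \<Longrightarrow> P j = Q j) \<Longrightarrow> heval r d c P = heval r d c Q"
  by (simp add: heval_def)

lemma subspace_hpolys: "fvs.subspace (hpolys r d :: ((nat \<Rightarrow> nat) \<Rightarrow> 'a::field) set)"
  by (auto simp: fvs.subspace_def hpolys_def fscale_def)

lemma subspace_vanishing_part:
  "fvs.subspace (vanishing_part r d Y :: ((nat \<Rightarrow> nat) \<Rightarrow> 'a::field) set)"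
  using subspace_hpolys[of r d, where 'a = 'a]
  by (auto simp: fvs.subspace_def vanishing_part_def heval_add heval_fscale) (simp add: heval_def)

text \<open>Rank-nullity as a count: a section \<open>g\<close> of the evaluation map
  \<open>T\<close> identifies the forms with pairs from kernel and image.\<close>

lemma card_evals:
  fixes Y :: "(nat \<Rightarrow> 'a::{finite,field}) set"
  shows "card (evals r d Y) = card (UNIV :: 'a set) ^ hilb r Y d"
proof -
  let ?q = "card (UNIV :: 'a set)"
  define H where "H = (hpolys r d :: ((nat \<Rightarrow> nat) \<Rightarrow> 'a) set)"
  define K where "K = vanishing_part r d Y"
  define T where "T c P = (if P \<in> Y then heval r d c P else 0)" for c P
  define g where "g = inv_into H T"
  have E: "evals r d Y = T ` H" unfolding evals_def T_def H_def by simp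
  have g: "g e \<in> H" "T (g e) = e" if "e \<in> T ` H" for e
    using that unfolding g_def by (auto simp: inv_into_into f_inv_into_f)
  have subH: "fvs.subspace H" unfolding H_def by (rule subspace_hpolys)
  have K: "k \<in> K \<longleftrightarrow> k \<in> H \<and> T k = (\<lambda>_. 0)" for k
    by (auto simp: K_def H_def T_def vanishing_part_def fun_eq_iff)
  have T_add: "T (c + c') = T c + T c'" and T_diff: "T (c - c') = T c - T c'" for c c'
    by (auto simp: T_def heval_add heval_diff fun_eq_iff)
  have "bij_betw (\<lambda>(k, e). k + g e) (K \<times> T ` H) H"
  proof (rule bij_betw_byWitness[where f' = "\<lambda>c. (c - g (T c), T c)"])
    show "\<forall>x\<in>K \<times> T ` H. ((case x of (k, e) \<Rightarrow> k + g e) - g (T (case x of (k, e) \<Rightarrow> k + g e)),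
        T (case x of (k, e) \<Rightarrow> k + g e)) = x"
    proof
      fix x assume "x \<in> K \<times> T ` H"
      then obtain k c where x: "x = (k, T c)" and k: "k \<in> K" and c: "c \<in> H" by auto
      have "T (k + g (T c)) = T c" using K[of k] k g(2)[OF imageI[OF c]] by (simp add: T_add fun_eq_iff)
      then show "((case x of (k, e) \<Rightarrow> k + g e) - g (T (case x of (k, e) \<Rightarrow> k + g e)),
        T (case x of (k, e) \<Rightarrow> k + g e)) = x" by (simp add: x)
    qed
    show "\<forall>c\<in>H. (case (c - g (T c), T c) of (k, e) \<Rightarrow> k + g e) = c" by simp
    show "(\<lambda>(k, e). k + g e) ` (K \<times> T ` H) \<subseteq> H"
      using K g(1) subH by (auto simp: fvs.subspace_add)
    show "(\<lambda>c. (c - g (T c), T c)) ` H \<subseteq> K \<times> T ` H"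
      using g[OF imageI] subH by (auto simp: K T_diff fun_eq_iff intro!: fvs.subspace_diff[OF subH])
  qed
  from bij_betw_same_card[OF this]
  have *: "card H = card K * card (evals r d Y)" by (simp add: card_cartesian_product E)
  have fin: "finite H" unfolding H_def hpolys_eq_supported by (intro finite_supported finite_mons)
  have KH: "K \<subseteq> H" using K by auto
  have cH: "card H = ?q ^ fdim H" using card_eq_power_fdim subH fin by blast
  have cK: "card K = ?q ^ fdim K"
    using card_eq_power_fdim[of K] subspace_vanishing_part fin KH finite_subset unfolding K_def by blast
  \<comment> \<open>Makes the truncated subtraction in \<open>hilb\<close> exact.\<close>
  have "?q ^ fdim K \<le> ?q ^ fdim H" using card_mono[OF fin KH] cH cK by simp
  then have le: "fdim K \<le> fdim H" using card_field_gt_1[where 'a = 'a] by simp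
  have "?q ^ fdim K * card (evals r d Y) = ?q ^ (fdim K + (fdim H - fdim K))" using * cH cK le by simp
  then have "?q ^ fdim K * card (evals r d Y) = ?q ^ fdim K * ?q ^ (fdim H - fdim K)"
    by (simp only: power_add)
  moreover have "?q ^ fdim K \<noteq> 0" by simp
  ultimately show ?thesis unfolding hilb_def K_def H_def by simp
qed

lemma evals_subset_supported: "evals r d Y \<subseteq> supported Y"
  by (auto simp: evals_def supported_def)

lemma hilb_le_card:
  fixes Y :: "(nat \<Rightarrow> 'a::{finite,field}) set"
  assumes "finite Y"
  shows "hilb r Y d \<le> card Y"
proof -
  have "card (UNIV :: 'a set) ^ hilb r Y d \<le> card (UNIV :: 'a set) ^ card Y"
    using card_mono[OF finite_supported[OF assms] evals_subset_supported, of r d]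
    by (simp add: card_evals card_supported[OF assms])
  then show ?thesis using card_field_gt_1[where 'a = 'a] by simp
qed

text \<open>Turns regularity into a question of interpolation by forms.\<close>

lemma hilb_eq_card_iff:
  fixes Y :: "(nat \<Rightarrow> 'a::{finite,field}) set"
  assumes "finite Y"
  shows "hilb r Y d = card Y \<longleftrightarrow> evals r d Y = supported Y"
proof
  assume "hilb r Y d = card Y"
  then show "evals r d Y = supported Y"
    by (intro card_subset_eq finite_supported assms evals_subset_supported)
      (simp add: card_evals card_supported[OF assms])
next
  assume "evals r d Y = supported Y"
  then have "card (UNIV :: 'a set) ^ hilb r Y d = card (UNIV :: 'a set) ^ card Y"
    using card_evals[of r d Y] card_supported[OF assms, where 'a = 'a] by simp
  then show "hilb r Y d = card Y" using card_field_gt_1[where 'a = 'a] by simp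
qed

text \<open>Forms are coefficient functions, so terms with equal exponents have to be merged:
  \<open>c m\<close> adds \<open>b\<close> over the fibre of \<open>a\<close> at \<open>m\<close>.
  Such collisions can occur when forms are pulled back.\<close>

lemma monomial_sum_is_form:
  assumes "finite K" "\<And>k. k \<in> K \<Longrightarrow> a k \<in> mons r d"
  shows "\<exists>c\<in>hpolys r d. \<forall>P. heval r d c P = (\<Sum>k\<in>K. b k * (\<Prod>j<r. P j ^ a k j))"
proof (intro bexI allI)
  define c where "c m = (\<Sum>k | k \<in> K \<and> a k = m. b k)" for m
  show "c \<in> hpolys r d" using assms(2) by (auto simp: hpolys_def c_def intro!: sum.neutral)
  fix P
  have "heval r d c P = (\<Sum>m\<in>mons r d. \<Sum>k | k \<in> K \<and> a k = m. b k * (\<Prod>j<r. P j ^ a k j))"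
    unfolding heval_def c_def sum_distrib_right by (intro sum.cong refl) auto
  also have "\<dots> = (\<Sum>k\<in>K. b k * (\<Prod>j<r. P j ^ a k j))"
    using assms by (intro sum.group finite_mons) auto
  finally show "heval r d c P = (\<Sum>k\<in>K. b k * (\<Prod>j<r. P j ^ a k j))" .
qed

section \<open>The projective torus as a product of unit groups\<close>

lemma torus_pts_eq:
  assumes "n \<ge> 1"
  shows "(torus_pts n :: (nat \<Rightarrow> 'a::field) set) = {x. x 0 = 1 \<and> (\<forall>j<n. x j \<noteq> 0) \<and> (\<forall>j\<ge>n. x j = 0)}"
proof
  show "(torus_pts n :: (nat \<Rightarrow> 'a) set) \<subseteq> {x. x 0 = 1 \<and> (\<forall>j<n. x j \<noteq> 0) \<and> (\<forall>j\<ge>n. x j = 0)}"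
    using assms by (auto simp: torus_pts_def normalize_pt_def)
  show "{x :: nat \<Rightarrow> 'a. x 0 = 1 \<and> (\<forall>j<n. x j \<noteq> 0) \<and> (\<forall>j\<ge>n. x j = 0)} \<subseteq> torus_pts n"
  proof clarify
    fix x :: "nat \<Rightarrow> 'a" assume x: "x 0 = 1" "\<forall>j<n. x j \<noteq> 0" "\<forall>j\<ge>n. x j = 0"
    then have "x = normalize_pt x" by (simp add: normalize_pt_def)
    with x show "x \<in> torus_pts n" unfolding torus_pts_def by blast
  qed
qed

lemma bij_betw_torus_PiE:
  assumes "n \<ge> 1"
  shows "bij_betw (\<lambda>x. restrict x {1..<n}) (torus_pts n :: (nat \<Rightarrow> 'a::field) set)
    ({1..<n} \<rightarrow>\<^sub>E UNIV - {0})"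
  by (rule bij_betw_byWitness[where f' = "\<lambda>g j. if j = 0 then 1 else if j < n then g j else 0"])
    (use assms in \<open>auto simp: torus_pts_eq fun_eq_iff PiE_def extensional_def Pi_def split: if_splits\<close>)

lemma card_torus_pts:
  assumes "n \<ge> 1"
  shows "card (torus_pts n :: (nat \<Rightarrow> 'a::{finite,field}) set) = (card (UNIV :: 'a set) - 1) ^ (n - 1)"
  using bij_betw_same_card[OF bij_betw_torus_PiE[OF assms, where 'a = 'a]]
  by (simp add: card_funcsetE card_Diff_singleton)

lemma finite_torus_pts:
  assumes "n \<ge> 1"
  shows "finite (torus_pts n :: (nat \<Rightarrow> 'a::{finite,field}) set)"
  using bij_betw_finite[OF bij_betw_torus_PiE[OF assms, where 'a = 'a]] by (simp add: finite_PiE)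

lemma sum_torus_prod:
  fixes \<phi> :: "nat \<Rightarrow> 'a::{finite,field} \<Rightarrow> 'a"
  assumes "n \<ge> 1"
  shows "(\<Sum>x\<in>torus_pts n. \<Prod>j\<in>{1..<n}. \<phi> j (x j)) = (\<Prod>j\<in>{1..<n}. \<Sum>y\<in>UNIV - {0}. \<phi> j y)"
proof -
  have "(\<Sum>x\<in>torus_pts n. \<Prod>j\<in>{1..<n}. \<phi> j (x j))
      = (\<Sum>x\<in>torus_pts n. \<Prod>j\<in>{1..<n}. \<phi> j (restrict x {1..<n} j))"
    by (intro sum.cong prod.cong) auto
  also have "\<dots> = (\<Sum>g\<in>{1..<n} \<rightarrow>\<^sub>E UNIV - {0}. \<Prod>j\<in>{1..<n}. \<phi> j (g j))"
    by (rule sum.reindex_bij_betw[OF bij_betw_torus_PiE[OF assms]])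
  also have "\<dots> = (\<Prod>j\<in>{1..<n}. \<Sum>y\<in>UNIV - {0}. \<phi> j y)"
    by (subst prod_sum_PiE) auto
  finally show ?thesis .
qed

section \<open>Power sums over the units\<close>

lemma field_power_card_minus_1:
  fixes x :: "'a::{finite,field}"
  assumes "x \<noteq> 0"
  shows "x ^ (card (UNIV :: 'a set) - 1) = 1"
proof -
  have "(\<Prod>y\<in>UNIV - {0}. y) = (\<Prod>y\<in>UNIV - {0}. x * y)"
    by (rule prod.reindex_bij_witness[of _ "\<lambda>y. x * y" "\<lambda>y. y / x"]) (use assms in auto)
  also have "\<dots> = x ^ (card (UNIV :: 'a set) - 1) * (\<Prod>y\<in>UNIV - {0}. y)"
    by (simp add: prod.distrib card_Diff_singleton)
  finally show ?thesis by simp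
qed

lemma of_nat_card_field: "of_nat (card (UNIV :: 'a set)) = (0 :: 'a::{finite,field})"
proof -
  have "(\<Sum>y\<in>UNIV. y) = (\<Sum>y\<in>UNIV. y + 1 :: 'a)"
    by (rule sum.reindex_bij_witness[of _ "\<lambda>y. y + 1" "\<lambda>y. y - 1"]) auto
  also have "\<dots> = (\<Sum>y\<in>UNIV. y) + of_nat (card (UNIV :: 'a set))" by (simp add: sum.distrib)
  finally show ?thesis by simp
qed

text \<open>At \<open>z = 1\<close> there are q - 1 terms, which add up to -1 since q is 0 in the
  field. With \<open>z = x / P\<close> the negated sum is the indicator of \<open>x = P\<close>
  among units.\<close>

lemma geometric_sum_field:
  fixes z :: "'a::{finite,field}"
  assumes "z \<noteq> 0"
  shows "(\<Sum>m<card (UNIV :: 'a set) - 1. z ^ m) = (if z = 1 then -1 else 0)"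
proof (cases "z = 1")
  case True
  have "of_nat (card (UNIV :: 'a set) - 1) = (of_nat (card (UNIV :: 'a set)) - 1 :: 'a)"
    using card_field_gt_1[where 'a = 'a] by (subst of_nat_diff) auto
  then show ?thesis using True by (simp add: of_nat_card_field)
next
  case False
  have "(1 - z) * (\<Sum>m<card (UNIV :: 'a set) - 1. z ^ m) = 0"
    using one_diff_power_eq[of z "card (UNIV :: 'a set) - 1"] field_power_card_minus_1[OF assms] by simp
  then show ?thesis using False by simp
qed

text \<open>The polynomial \<open>x ^ m - 1\<close> has too few roots to vanish at all q - 1 units,
  so some unit has \<open>z ^ m\<close> different from 1; the substitution of \<open>z * y\<close>
  for \<open>y\<close> then multiplies the sum by \<open>z ^ m\<close>.\<close>

lemma sum_powers_eq_0:
  assumes "0 < m" "m < card (UNIV :: 'a set) - 1"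
  shows "(\<Sum>y\<in>UNIV - {0}. y ^ m) = (0 :: 'a::{finite,field})"
proof -
  obtain z :: 'a where z: "z \<noteq> 0" "z ^ m \<noteq> 1"
  proof (rule ccontr)
    assume "\<not> thesis"
    with that have all: "z ^ m = 1" if "z \<noteq> 0" for z :: 'a using \<open>z \<noteq> 0\<close> by blast
    define p where "p = (monom 1 m + [:- 1:] :: 'a poly)"
    have deg: "degree p = m" using assms(1) by (simp add: p_def degree_add_eq_left degree_monom_eq)
    then have "p \<noteq> 0" using assms(1) by auto
    then have "card {x. poly p x = 0} \<le> m" using card_poly_roots_bound[of p] deg by simp
    moreover have "card (UNIV - {0 :: 'a}) \<le> card {x. poly p x = 0}"
      using all by (intro card_mono) (auto simp: p_def poly_monom)
    ultimately show False using assms(2) by (simp add: card_Diff_singleton)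
  qed
  have "(\<Sum>y\<in>UNIV - {0}. y ^ m) = (\<Sum>y\<in>UNIV - {0}. (z * y) ^ m)"
    by (rule sum.reindex_bij_witness[of _ "\<lambda>y. z * y" "\<lambda>y. y / z"]) (use z in auto)
  also have "\<dots> = z ^ m * (\<Sum>y\<in>UNIV - {0}. y ^ m)"
    by (simp add: power_mult_distrib sum_distrib_left)
  finally show ?thesis using z(2) by simp
qed

lemma lessThan_eq_insert_0: "(n::nat) \<ge> 1 \<Longrightarrow> {..<n} = insert 0 {1..<n}"
  by auto

text \<open>The indicator of a point is a product of geometric sums in the \<open>n - 1\<close>
  affine coordinates, each with exponents up to q - 2; this is the origin of the bound.\<close>

lemma evals_torus_full:
  assumes n: "n \<ge> 1" and d: "d \<ge> (card (UNIV :: 'a set) - 2) * (n - 1)"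
  shows "evals n d (torus_pts n :: (nat \<Rightarrow> 'a::{finite,field}) set) = supported (torus_pts n)"
proof (rule antisym[OF evals_subset_supported], rule subsetI)
  let ?T = "torus_pts n :: (nat \<Rightarrow> 'a) set" and ?q = "card (UNIV :: 'a set)"
  define G where "G = ({1..<n} \<rightarrow>\<^sub>E {..<?q - 1})"
  \<comment> \<open>The first variable tops the degree up to \<open>d\<close> and has value 1 on the
    torus; the bound on \<open>d\<close> makes the truncated subtraction exact.\<close>
  define ex where "ex g = (\<lambda>j. if j = 0 then d - (\<Sum>j\<in>{1..<n}. g j) else if j < n then g j else 0)"
    for g :: "nat \<Rightarrow> nat"
  have finG: "finite G" by (simp add: G_def finite_PiE)
  have ex_mons: "ex g \<in> mons n d" if g: "g \<in> G" for g
  proof -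
    have "(\<Sum>j\<in>{1..<n}. g j) \<le> (\<Sum>j\<in>{1..<n}. ?q - 2)"
      using g by (intro sum_mono) (fastforce simp: G_def PiE_def Pi_def)
    then have "(\<Sum>j\<in>{1..<n}. g j) \<le> d" using d by (simp add: mult.commute)
    moreover have "(\<Sum>j\<in>{1..<n}. ex g j) = (\<Sum>j\<in>{1..<n}. g j)"
      by (intro sum.cong) (auto simp: ex_def)
    ultimately have "(\<Sum>j<n. ex g j) = d" using n by (simp add: lessThan_eq_insert_0 ex_def)
    with n show ?thesis by (auto simp: mons_def ex_def)
  qed
  have "\<exists>c\<in>hpolys n d. \<forall>x\<in>?T. heval n d c x = (if x = P then 1 else 0)" if P: "P \<in> ?T" for P
  proof -
    obtain c where c: "c \<in> hpolys n d"
      "\<And>x. heval n d c x = (\<Sum>g\<in>G. (\<Prod>j\<in>{1..<n}. - (1 / P j ^ g j)) * (\<Prod>j<n. x j ^ ex g j))"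
      using monomial_sum_is_form[of G ex n d "\<lambda>g. \<Prod>j\<in>{1..<n}. - (1 / P j ^ g j)"] finG ex_mons
      by blast
    have "heval n d c x = (if x = P then 1 else 0)" if x: "x \<in> ?T" for x
    proof -
      have mono: "(\<Prod>j<n. x j ^ ex g j) = (\<Prod>j\<in>{1..<n}. x j ^ g j)" for g
      proof -
        have "(\<Prod>j\<in>{1..<n}. x j ^ ex g j) = (\<Prod>j\<in>{1..<n}. x j ^ g j)"
          by (intro prod.cong) (auto simp: ex_def)
        then show ?thesis using x n by (simp add: lessThan_eq_insert_0 torus_pts_eq)
      qed
      have "heval n d c x = (\<Sum>g\<in>G. \<Prod>j\<in>{1..<n}. - ((x j / P j) ^ g j))"
        unfolding c(2) mono by (simp add: prod.distrib[symmetric] power_divide)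
      also have "\<dots> = (\<Prod>j\<in>{1..<n}. \<Sum>m<?q - 1. - ((x j / P j) ^ m))"
        unfolding G_def by (subst prod_sum_PiE) auto
      also have "\<dots> = (\<Prod>j\<in>{1..<n}. if x j = P j then 1 else 0)"
      proof (rule prod.cong[OF refl])
        fix j assume "j \<in> {1..<n}"
        then have "x j \<noteq> 0" "P j \<noteq> 0" using x P n by (auto simp: torus_pts_eq)
        then show "(\<Sum>m<?q - 1. - ((x j / P j) ^ m)) = (if x j = P j then 1 else 0)"
          using geometric_sum_field[of "x j / P j"] by (simp add: sum_negf)
      qed
      also have "\<dots> = (if x = P then 1 else 0)"
      proof (cases "x = P")
        case False
        then obtain j where j: "x j \<noteq> P j" by auto
        have "j \<noteq> 0" using j x P n by (cases "j = 0") (auto simp: torus_pts_eq)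
        moreover have "j < n" using j x P n by (cases "j < n") (auto simp: torus_pts_eq)
        ultimately have "j \<in> {1..<n}" by simp
        with j False show ?thesis by auto
      qed simp
      finally show ?thesis .
    qed
    with c(1) show ?thesis by blast
  qed
  then obtain C where C: "\<And>P. P \<in> ?T \<Longrightarrow> C P \<in> hpolys n d"
    "\<And>P x. P \<in> ?T \<Longrightarrow> x \<in> ?T \<Longrightarrow> heval n d (C P) x = (if x = P then 1 else 0)"
    by metis
  fix F :: "(nat \<Rightarrow> 'a) \<Rightarrow> 'a" assume F: "F \<in> supported ?T"
  define c where "c m = (\<Sum>P\<in>?T. F P * C P m)" for m
  have "c \<in> hpolys n d" using C(1) by (auto simp: c_def hpolys_def intro!: sum.neutral)
  moreover have "heval n d c x = F x" if x: "x \<in> ?T" for x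
  proof -
    have "heval n d c x = (\<Sum>m\<in>mons n d. \<Sum>P\<in>?T. F P * (C P m * (\<Prod>j<n. x j ^ m j)))"
      by (simp add: heval_def c_def sum_distrib_right mult.assoc)
    also have "\<dots> = (\<Sum>P\<in>?T. F P * heval n d (C P) x)"
      unfolding heval_def sum_distrib_left by (rule sum.swap)
    also have "\<dots> = (\<Sum>P\<in>?T. if x = P then F P else 0)"
      using C(2) x by (intro sum.cong) auto
    also have "\<dots> = F x" using x finite_torus_pts[OF n, where 'a = 'a] by simp
    finally show ?thesis .
  qed
  ultimately show "F \<in> evals n d ?T"
    unfolding evals_def using F
    by (intro image_eqI[of _ _ c]) (auto simp: supported_def fun_eq_iff)
qed

text \<open>In low degree every form is orthogonal on the torus to the monomial
  \<open>t\<^sub>1 \<cdots> t\<^sub>n\<^sub>-\<^sub>1\<close>, since some power sum over the units vanishes.\<close>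

lemma evals_torus_not_full:
  assumes n: "n \<ge> 1" and d: "d < (card (UNIV :: 'a set) - 2) * (n - 1)"
  shows "evals n d (torus_pts n :: (nat \<Rightarrow> 'a::{finite,field}) set) \<noteq> supported (torus_pts n)"
proof
  let ?T = "torus_pts n :: (nat \<Rightarrow> 'a) set" and ?q = "card (UNIV :: 'a set)"
  assume full: "evals n d ?T = supported ?T"
  \<comment> \<open>The indicator of this all-ones point pairs to 1 with the test monomial, while
    every form of degree \<open>d\<close> pairs to 0.\<close>
  define P where "P = (\<lambda>j. if j < n then 1 else 0 :: 'a)"
  have P: "P \<in> ?T" using n by (simp add: torus_pts_eq P_def)
  have "(\<lambda>x. if x = P then 1 else 0 :: 'a) \<in> supported ?T" using P by (auto simp: supported_def)
  then obtain c where eq: "(\<lambda>x. if x = P then 1 else 0) = (\<lambda>x. if x \<in> ?T then heval n d c x else 0)"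
    unfolding full[symmetric] evals_def by auto
  have c: "heval n d c x = (if x = P then 1 else 0)" if "x \<in> ?T" for x
    using fun_cong[OF eq, of x] that by simp
  have zero: "(\<Sum>x\<in>?T. (\<Prod>j<n. x j ^ a j) * (\<Prod>j\<in>{1..<n}. x j)) = 0" if a: "a \<in> mons n d" for a
  proof -
    \<comment> \<open>By pigeonhole; then \<open>Suc (a k)\<close> lies strictly between 0 and q -
      1, where power sums vanish.\<close>
    have "\<exists>j\<in>{1..<n}. a j < ?q - 2"
    proof (rule ccontr)
      assume "\<not> ?thesis"
      then have "(\<Sum>j\<in>{1..<n}. ?q - 2) \<le> (\<Sum>j\<in>{1..<n}. a j)" by (intro sum_mono) (simp add: not_less)
      also have "\<dots> \<le> (\<Sum>j<n. a j)" by (intro sum_mono2) auto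
      finally show False using a d by (simp add: mons_def mult.commute)
    qed
    then obtain k where k: "k \<in> {1..<n}" "a k < ?q - 2" by blast
    have "(\<Sum>x\<in>?T. (\<Prod>j<n. x j ^ a j) * (\<Prod>j\<in>{1..<n}. x j))
        = (\<Sum>x\<in>?T. \<Prod>j\<in>{1..<n}. x j ^ Suc (a j))"
      using n by (intro sum.cong refl)
        (simp add: torus_pts_eq lessThan_eq_insert_0 prod.distrib mult.commute)
    also have "\<dots> = (\<Prod>j\<in>{1..<n}. \<Sum>y\<in>UNIV - {0}. y ^ Suc (a j))"
      by (rule sum_torus_prod[OF n])
    also have "\<dots> = 0"
    proof (rule prod_zero)
      have "(\<Sum>y\<in>UNIV - {0}. y ^ Suc (a k)) = (0::'a)" using k by (intro sum_powers_eq_0) auto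
      with k show "\<exists>j\<in>{1..<n}. (\<Sum>y\<in>UNIV - {0}. y ^ Suc (a j)) = (0::'a)" by blast
    qed simp
    finally show ?thesis .
  qed
  have "(\<Sum>x\<in>?T. heval n d c x * (\<Prod>j\<in>{1..<n}. x j))
      = (\<Sum>x\<in>?T. \<Sum>a\<in>mons n d. c a * ((\<Prod>j<n. x j ^ a j) * (\<Prod>j\<in>{1..<n}. x j)))"
    by (simp add: heval_def sum_distrib_right mult.assoc)
  also have "\<dots> = (\<Sum>a\<in>mons n d. c a * (\<Sum>x\<in>?T. (\<Prod>j<n. x j ^ a j) * (\<Prod>j\<in>{1..<n}. x j)))"
    unfolding sum_distrib_left by (rule sum.swap)
  also have "\<dots> = 0" using zero by simp
  finally have "(\<Sum>x\<in>?T. heval n d c x * (\<Prod>j\<in>{1..<n}. x j)) = 0" .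
  moreover have "(\<Sum>x\<in>?T. heval n d c x * (\<Prod>j\<in>{1..<n}. x j))
      = (\<Sum>x\<in>?T. if x = P then \<Prod>j\<in>{1..<n}. P j else 0)"
    using c by (intro sum.cong) auto
  moreover have "\<dots> = (\<Prod>j\<in>{1..<n}. P j)" using P finite_torus_pts[OF n, where 'a = 'a] by (simp del: One_nat_def)
  moreover have "(\<Prod>j\<in>{1..<n}. P j) = 1" by (intro prod.neutral) (auto simp: P_def)
  ultimately show False by (metis one_neq_zero)
qed

lemma reg_quot_torus_pts:
  assumes n: "n \<ge> 1"
  shows "reg_quot n (torus_pts n :: (nat \<Rightarrow> 'a::{finite,field}) set) = (card (UNIV :: 'a set) - 2) * (n - 1)"
  unfolding reg_quot_def hilb_eq_card_iff[OF finite_torus_pts[OF n]]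
proof (rule Least_equality)
  show "\<forall>d\<ge>(card (UNIV :: 'a set) - 2) * (n - 1).
      evals n d (torus_pts n :: (nat \<Rightarrow> 'a) set) = supported (torus_pts n)"
    using evals_torus_full[OF n] by blast
  fix p assume "\<forall>d\<ge>p. evals n d (torus_pts n :: (nat \<Rightarrow> 'a) set) = supported (torus_pts n)"
  then show "(card (UNIV :: 'a set) - 2) * (n - 1) \<le> p"
    using evals_torus_not_full[OF n, of p, where 'a = 'a] by (meson not_less order_refl)
qed

section \<open>Clutters\<close>

definition edge_vec :: "(nat \<Rightarrow> nat set) \<Rightarrow> nat \<Rightarrow> nat \<Rightarrow> int" where
  "edge_vec f i j = (if j \<in> f i then 1 else 0)"

definition unit_diff :: "nat \<Rightarrow> nat \<Rightarrow> int" where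
  "unit_diff a j = (if j = a then 1 else 0) - (if j = 0 then 1 else 0)"

lemma sum_fun_apply: "(\<Sum>j\<in>A. F j) k = (\<Sum>j\<in>A. F j k)"
  by (induction A rule: infinite_finite_induct) auto

text \<open>If \<open>g j0\<close> were nonzero, all edges would lie in a hyperplane spanned by
  \<open>n - 1\<close> real vectors. This carries the real rank over to integral
  functionals.\<close>

lemma incidence_rank_full_kernel:
  assumes sub: "\<And>i. i < s \<Longrightarrow> f i \<subseteq> {..<n}" and rank: "incidence_rank s f = n"
    and g: "\<And>i. i < s \<Longrightarrow> ip n g (edge_vec f i) = 0" and j0: "j0 < n"
  shows "g j0 = 0"
proof (rule ccontr)
  assume g0: "g j0 \<noteq> 0"
  define e :: "nat \<Rightarrow> nat \<Rightarrow> real" where "e j = (\<lambda>k. if k = j then 1 else 0)" for j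
  \<comment> \<open>These span the hyperplane: a vector in it has its own coordinates apart from
    \<open>j0\<close> as coefficients.\<close>
  define b where "b j = e j - fscale (g j / g j0) (e j0)" for j
  define W where "W = b ` ({..<n} - {j0})"
  have "char_vec (f i) \<in> fvs.span W" if i: "i < s" for i
  proof -
    let ?a = "char_vec (f i)"
    have a0: "?a k = 0" if "k \<ge> n" for k using sub[OF i] that by (auto simp: char_vec_def)
    have "(\<Sum>j<n. g j * ?a j) = real_of_int (ip n g (edge_vec f i))"
      by (simp add: ip_def edge_vec_def char_vec_def if_distrib cong: if_cong)
    then have "(\<Sum>j<n. g j * ?a j) = 0" using g[OF i] by simp
    then have ga: "(\<Sum>j\<in>{..<n} - {j0}. g j * ?a j) = - g j0 * ?a j0"
      using j0 sum.remove[of "{..<n}" j0 "\<lambda>j. g j * ?a j"] by simp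
    have "?a = (\<Sum>j\<in>{..<n} - {j0}. fscale (?a j) (b j))"
    proof
      fix k
      have "(\<Sum>j\<in>{..<n} - {j0}. fscale (?a j) (b j)) k
          = (\<Sum>j\<in>{..<n} - {j0}. ?a j * e j k) - (\<Sum>j\<in>{..<n} - {j0}. g j * ?a j) * e j0 k / g j0"
        by (simp add: sum_fun_apply fscale_def b_def sum_distrib_left sum_divide_distrib sum_subtractf
            algebra_simps)
      also have "\<dots> = (\<Sum>j\<in>{..<n} - {j0}. ?a j * e j k) + ?a j0 * e j0 k"
        unfolding ga using g0 by simp
      also have "\<dots> = (\<Sum>j<n. ?a j * e j k)" using j0 by (simp add: sum.remove[of _ j0])
      also have "\<dots> = (\<Sum>j<n. if k = j then ?a j else 0)" by (intro sum.cong) (auto simp: e_def)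
      also have "\<dots> = ?a k" using a0 by simp
      finally show "?a k = (\<Sum>j\<in>{..<n} - {j0}. fscale (?a j) (b j)) k" by simp
    qed
    also have "\<dots> \<in> fvs.span W"
      by (intro fvs.span_sum fvs.span_scale fvs.span_base) (simp add: W_def)
    finally show ?thesis .
  qed
  then have "fvs.dim {char_vec (f i) | i. i < s} \<le> card W"
    by (intro fvs.dim_le_card) (auto simp: W_def)
  also have "card W \<le> card ({..<n} - {j0})" unfolding W_def by (intro card_image_le) simp
  also have "\<dots> < n" using j0 by simp
  finally show False using rank by (simp add: incidence_rank_def fdim_def)
qed

lemma sum_edge_vec:
  assumes "f i \<subseteq> {..<n}"
  shows "ip n (\<lambda>_. 1) (edge_vec f i) = int (card (f i))"
proof -
  have "{..<n} \<inter> f i = f i" using assms by auto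
  then show ?thesis by (simp add: ip_def edge_vec_def sum.If_cases Collect_mem_eq)
qed

lemma sum_unit_diff: "a < n \<Longrightarrow> ip n (\<lambda>_. 1) (unit_diff a) = 0"
  by (simp add: ip_def unit_diff_def sum_subtractf)

text \<open>For a uniform clutter, divisibility by a product of \<open>d\<close> edge monomials together with equality
  of degrees is equality.\<close>

lemma normal_edge_ideal_nspan:
  assumes sub: "\<And>i. i < s \<Longrightarrow> f i \<subseteq> {..<n}" and k: "\<And>i. i < s \<Longrightarrow> card (f i) = k" "k > 0"
    and normal: "normal_edge_ideal n s f"
    and deg: "ip n (\<lambda>_. 1) a = int k * d" and p: "p \<ge> 1"
    and pa: "(\<lambda>j. p * a j) \<in> nspan n (edge_vec f) {..<s}"
  shows "a \<in> nspan n (edge_vec f) {..<s}"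
proof -
  obtain c where c: "\<And>i. i \<in> {..<s} \<Longrightarrow> c i \<ge> 0"
    "\<And>j. j < n \<Longrightarrow> p * a j = (\<Sum>i<s. c i * edge_vec f i j)"
    using pa by (rule nspanE) blast
  have ek: "ip n (\<lambda>_. 1) (edge_vec f i) = int k" if "i < s" for i
    using sum_edge_vec[OF sub] k that by simp
  have "p * ip n (\<lambda>_. 1) a = ip n (\<lambda>_. 1) (\<lambda>j. p * a j)" by (simp add: ip_def sum_distrib_left)
  also have "\<dots> = (\<Sum>i<s. c i * ip n (\<lambda>_. 1) (edge_vec f i))" by (rule ip_comb) (rule c(2))
  also have "\<dots> = int k * (\<Sum>i<s. c i)" by (simp add: ek sum_distrib_left mult.commute)
  \<comment> \<open>Comparing degrees fixes the power of the ideal: the multiplicities in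
    \<open>p * a\<close> add up to exactly \<open>p * d\<close>.\<close>
  finally have pd: "(\<Sum>i<s. c i) = p * d" using deg k(2) by simp
  moreover have "(\<Sum>i<s. c i) \<ge> 0" using c(1) by (intro sum_nonneg) auto
  ultimately have d0: "d \<ge> 0" using p by (simp add: zero_le_mult_iff)
  have a0: "a j \<ge> 0" if "j < n" for j
  proof -
    have "p * a j \<ge> 0" unfolding c(2)[OF that] using c(1) by (intro sum_nonneg) (auto simp: edge_vec_def)
    then show ?thesis using p by (simp add: zero_le_mult_iff)
  qed
  define a' where "a' j = (if j < n then nat (a j) else 0)" for j
  have int_sum: "int (\<Sum>i<s. m i * (if j \<in> f i then 1 else 0)) = (\<Sum>i<s. int (m i) * edge_vec f i j)"
    for m :: "nat \<Rightarrow> nat" and j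
    by (simp add: edge_vec_def if_distrib cong: if_cong)
  have "mono_in_power s f (nat p * nat d) (\<lambda>j. nat p * a' j)"
    unfolding mono_in_power_def
  proof (intro exI[of _ "\<lambda>i. nat (c i)"] conjI allI)
    have "int (\<Sum>i<s. nat (c i)) = p * d" using c(1) pd by simp
    also have "\<dots> = int (nat p * nat d)" using p d0 by simp
    finally show "(\<Sum>i<s. nat (c i)) = nat p * nat d" by (simp only: of_nat_eq_iff)
    fix j
    show "(\<Sum>i<s. nat (c i) * (if j \<in> f i then 1 else 0)) \<le> nat p * a' j"
    proof (cases "j < n")
      case True
      have "int (\<Sum>i<s. nat (c i) * (if j \<in> f i then 1 else 0)) = p * a j"
        unfolding int_sum c(2)[OF True] using c(1) by (intro sum.cong) auto
      also have "\<dots> = int (nat p * a' j)" using True p a0 by (simp add: a'_def)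
      finally show ?thesis by (simp only: of_nat_eq_iff)
    next
      case False
      have "(\<Sum>i<s. nat (c i) * (if j \<in> f i then 1 else 0)) = 0"
        using sub False by (intro sum.neutral) auto
      then show ?thesis by (metis le0)
    qed
  qed
  then have "mono_in_closure s f (nat d) a'"
    unfolding mono_in_closure_def using p by (intro exI[of _ "nat p"]) auto
  have "mono_in_power s f (nat d) a'"
  proof (cases "nat d \<ge> 1")
    case True
    with \<open>mono_in_closure s f (nat d) a'\<close> normal show ?thesis
      unfolding normal_edge_ideal_def by (auto simp: a'_def)
  next
    \<comment> \<open>Power 0 is the unit ideal, outside the range \<open>i \<ge> 1\<close> of
      \<open>normal_edge_ideal\<close>.\<close>
    case False
    then show ?thesis unfolding mono_in_power_def by (intro exI[of _ "\<lambda>_. 0"]) simp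
  qed
  then obtain m :: "nat \<Rightarrow> nat" where m: "(\<Sum>i<s. m i) = nat d"
    "\<And>j. (\<Sum>i<s. m i * (if j \<in> f i then 1 else 0)) \<le> a' j"
    unfolding mono_in_power_def by blast
  \<comment> \<open>The exponent left after division by the edge monomials: nonnegative with
    coordinate sum 0, hence zero.\<close>
  define r where "r j = a j - (\<Sum>i<s. int (m i) * edge_vec f i j)" for j
  have r0: "r j \<ge> 0" if "j < n" for j
  proof -
    have "(\<Sum>i<s. int (m i) * edge_vec f i j) \<le> int (a' j)"
      unfolding int_sum[symmetric] using m(2)[of j] by (simp only: of_nat_le_iff)
    then show ?thesis using that a0 by (simp add: r_def a'_def)
  qed
  have "ip n (\<lambda>_. 1) (\<lambda>j. \<Sum>i<s. int (m i) * edge_vec f i j)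
      = (\<Sum>i<s. int (m i) * ip n (\<lambda>_. 1) (edge_vec f i))"
    by (rule ip_comb) simp
  also have "\<dots> = int k * int (\<Sum>i<s. m i)" by (simp add: ek sum_distrib_left mult.commute)
  also have "\<dots> = int k * d" using m(1) d0 by simp
  finally have "(\<Sum>j<n. r j) = 0" using deg by (simp add: ip_def r_def sum_subtractf)
  then have "r j = 0" if "j < n" for j
    using that r0 by (subst (asm) sum_nonneg_eq_0_iff) auto
  then show ?thesis by (intro nspanI[where c = "\<lambda>i. int (m i)"]) (auto simp: r_def)
qed

text \<open>Normality acts twice: it provides a lattice basis \<open>B\<close> of edges, and it puts
  \<open>unit_diff a\<close> into the lattice. Full rank gives this for a multiple; a shift by the
  sum of all edges reaches the cone and keeps the degree a multiple of \<open>k\<close>.\<close>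

lemma unimodular_edges_exist:
  assumes sub: "\<And>i. i < s \<Longrightarrow> f i \<subseteq> {..<n}" and k: "\<And>i. i < s \<Longrightarrow> card (f i) = k" "k > 0"
    and rank: "incidence_rank s f = n" and normal: "normal_edge_ideal n s f" and n: "n \<ge> 2"
  obtains \<iota> where "\<And>j. j < n \<Longrightarrow> \<iota> j < s"
    "\<And>a. a < n \<Longrightarrow> unit_diff a \<in> zspan n (edge_vec f) (\<iota> ` {..<n})"
proof -
  let ?v = "edge_vec f"
  have ek: "ip n (\<lambda>_. 1) (?v i) = int k" if "i < s" for i
    using sum_edge_vec[OF sub] k that by simp
  have degz: "ip n (\<lambda>_. 1) a = int k * (\<Sum>i<s. c i)"
    if "\<And>j. j < n \<Longrightarrow> a j = (\<Sum>i<s. c i * ?v i j)" for a c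
  proof -
    have "ip n (\<lambda>_. 1) a = (\<Sum>i<s. c i * ip n (\<lambda>_. 1) (?v i))" by (rule ip_comb) (rule that)
    then show ?thesis by (simp add: ek sum_distrib_left mult.commute)
  qed
  have "normal_config n ?v {..<s}"
    unfolding normal_config_def
  proof (intro ballI allI impI)
    fix a and p :: int
    assume a: "a \<in> zspan n ?v {..<s}" and p: "1 \<le> p" "(\<lambda>j. p * a j) \<in> nspan n ?v {..<s}"
    obtain c where "\<And>j. j < n \<Longrightarrow> a j = (\<Sum>i<s. c i * ?v i j)" using a by (rule zspanE) blast
    from normal_edge_ideal_nspan[OF sub k normal degz[OF this] p] show "a \<in> nspan n ?v {..<s}" .
  qed
  from normal_config_basis[OF _ this, of "\<lambda>_. 1"] ek k(2) obtain B where
    B: "B \<subseteq> {..<s}" "zspan n ?v {..<s} \<subseteq> zspan n ?v B"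
      "\<And>c. (\<forall>j<n. (\<Sum>i\<in>B. c i * ?v i j) = 0) \<Longrightarrow> (\<forall>i\<in>B. c i = 0)"
    by (metis finite_lessThan lessThan_iff of_nat_0_less_iff)
  have finB: "finite B" using B(1) finite_subset by blast
  have "card B \<le> n" using dependent_if_card_gt[OF finB, of n ?v] B(3) by (meson not_less)
  have unit: "unit_diff a \<in> zspan n ?v {..<s}" if a: "a < n" for a
  proof -
    have "\<exists>p\<ge>1. (\<lambda>j. p * unit_diff a j) \<in> zspan n ?v {..<s}"
    proof (rule ccontr)
      assume "\<not> ?thesis"
      with multiple_in_zspan_or_separated[of "{..<s}" "unit_diff a" n ?v] obtain g where
        g: "\<forall>i\<in>{..<s}. ip n g (?v i) = 0" "ip n g (unit_diff a) \<noteq> 0" by blast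
      have "g j = 0" if "j < n" for j
        using incidence_rank_full_kernel[OF sub rank _ that, of g] g(1) by auto
      then show False using g(2) by (simp add: ip_def)
    qed
    then obtain p where p: "p \<ge> 1" "(\<lambda>j. p * unit_diff a j) \<in> zspan n ?v {..<s}" by blast
    obtain c where c: "\<And>j. j < n \<Longrightarrow> p * unit_diff a j = (\<Sum>i<s. c i * ?v i j)"
      using p(2) by (rule zspanE) blast
    obtain N where N: "\<And>i. i \<in> {..<s} \<Longrightarrow> c i + p * N \<ge> 0"
      using finite_shift_nonneg[of "{..<s}" p c] p(1) by auto
    define a' where "a' j = unit_diff a j + N * (\<Sum>i<s. ?v i j)" for j
    have sz: "(\<lambda>j. \<Sum>i<s. ?v i j) \<in> zspan n ?v {..<s}" by (rule zspanI[where c = "\<lambda>_. 1"]) simp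
    have "ip n (\<lambda>_. 1) (\<lambda>j. \<Sum>i<s. ?v i j) = int k * (\<Sum>i<s. 1)" by (rule degz) simp
    then have deg: "ip n (\<lambda>_. 1) a' = int k * (N * int s)"
      using ip_lincomb[of n "\<lambda>_. 1" 1 "unit_diff a" N "\<lambda>j. \<Sum>i<s. ?v i j"] sum_unit_diff[OF a]
      by (simp add: a'_def[abs_def])
    have "(\<lambda>j. p * a' j) \<in> nspan n ?v {..<s}"
      by (rule nspanI[where c = "\<lambda>i. c i + p * N"])
        (use N c in \<open>auto simp: a'_def algebra_simps sum.distrib sum_distrib_left\<close>)
    from normal_edge_ideal_nspan[OF sub k normal deg p(1) this]
    have "a' \<in> zspan n ?v {..<s}" using nspan_subset_zspan by blast
    from zspan_lincomb[OF this sz, of 1 "-N"] show ?thesis by (simp add: a'_def)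
  qed
  have "B \<noteq> {}"
  proof
    assume "B = {}"
    moreover have "unit_diff 1 \<in> zspan n ?v B" using unit[of 1] B(2) n by auto
    ultimately have "unit_diff 1 1 = 0" using n by (auto elim!: zspanE)
    then show False by (simp add: unit_diff_def)
  qed
  then obtain b where b: "b \<in> B" by blast
  obtain h where h: "bij_betw h {0..<card B} B" using ex_bij_betw_nat_finite[OF finB] by blast
  \<comment> \<open>Positions from \<open>card B\<close> on repeat \<open>b\<close>, so that the
    image is \<open>B\<close> as soon as \<open>card B \<le> n\<close>.\<close>
  define \<iota> where "\<iota> j = (if j < card B then h j else b)" for j
  have "\<iota> ` {..<n} = B"
  proof
    show "\<iota> ` {..<n} \<subseteq> B" using b bij_betwE[OF h] by (auto simp: \<iota>_def)
    show "B \<subseteq> \<iota> ` {..<n}"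
    proof
      fix x assume "x \<in> B"
      then obtain j where "j < card B" "x = h j" using bij_betw_imp_surj_on[OF h] by force
      then show "x \<in> \<iota> ` {..<n}" using \<open>card B \<le> n\<close>
        by (intro image_eqI[of _ _ j]) (auto simp: \<iota>_def)
    qed
  qed
  with that[of \<iota>] unit B(1,2) show ?thesis by blast
qed

section \<open>From the exponent lattice to points and forms\<close>

lemma power_int_prod: "(\<Prod>j\<in>A. x j :: 'a::field) powi c = (\<Prod>j\<in>A. x j powi c)"
  by (induction A rule: infinite_finite_induct) (auto simp: power_int_mult_distrib)

lemma power_int_sum: "(x :: 'a::field) \<noteq> 0 \<Longrightarrow> x powi (\<Sum>i\<in>A. c i) = (\<Prod>i\<in>A. x powi c i)"
  by (induction A rule: infinite_finite_induct) (auto simp: power_int_add)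

text \<open>The monomial with exponent \<open>unit_diff a\<close> takes the value
  \<open>z a / z 0\<close>; written through edges it becomes \<open>l\<close> to the sum of the
  coefficients. Coordinate sums show that \<open>k\<close> times this sum is 0.\<close>

lemma coordinates_eq_if_products_const:
  fixes z :: "nat \<Rightarrow> 'a::field"
  assumes z: "\<And>j. j < n \<Longrightarrow> z j \<noteq> 0" and B: "\<And>i. i \<in> B \<Longrightarrow> f i \<subseteq> {..<n}"
    and k: "\<And>i. i \<in> B \<Longrightarrow> card (f i) = k" "k > 0"
    and const: "\<And>i. i \<in> B \<Longrightarrow> (\<Prod>j\<in>f i. z j) = l" and l: "l \<noteq> 0"
    and a: "a < n" "unit_diff a \<in> zspan n (edge_vec f) B"
  shows "z a = z 0"
proof -
  let ?v = "edge_vec f"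
  obtain c where c: "\<And>j. j < n \<Longrightarrow> unit_diff a j = (\<Sum>i\<in>B. c i * ?v i j)"
    using a(2) by (rule zspanE) blast
  have "ip n (\<lambda>_. 1) (unit_diff a) = (\<Sum>i\<in>B. c i * ip n (\<lambda>_. 1) (?v i))"
    by (rule ip_comb) (rule c)
  also have "\<dots> = (\<Sum>i\<in>B. c i) * int k"
    unfolding sum_distrib_right using sum_edge_vec[OF B] k(1) by (intro sum.cong) auto
  finally have sum0: "(\<Sum>i\<in>B. c i) = 0" using sum_unit_diff[OF a(1)] k(2) by simp
  have edge: "(\<Prod>j\<in>f i. z j) = (\<Prod>j<n. z j powi ?v i j)" if "i \<in> B" for i
    using B[OF that] by (intro prod.mono_neutral_cong_left) (auto simp: edge_vec_def)
  have "1 = l powi (\<Sum>i\<in>B. c i)" by (simp add: sum0)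
  also have "\<dots> = (\<Prod>i\<in>B. l powi c i)" by (rule power_int_sum[OF l])
  also have "\<dots> = (\<Prod>i\<in>B. \<Prod>j<n. z j powi (c i * ?v i j))"
  proof (rule prod.cong[OF refl])
    fix i assume i: "i \<in> B"
    have "l powi c i = (\<Prod>j<n. z j powi ?v i j) powi c i" using edge[OF i] const[OF i] by simp
    then show "l powi c i = (\<Prod>j<n. z j powi (c i * ?v i j))"
      by (simp add: power_int_prod mult.commute[of "c i"] power_int_mult)
  qed
  also have "\<dots> = (\<Prod>j<n. \<Prod>i\<in>B. z j powi (c i * ?v i j))" by (rule prod.swap)
  also have "\<dots> = (\<Prod>j<n. z j powi unit_diff a j)"
    using z c by (intro prod.cong) (auto simp: power_int_sum)
  also have "\<dots> = (\<Prod>j<n. (if j = a then z j else 1) / (if j = 0 then z j else 1))"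
    using z by (intro prod.cong) (auto simp: unit_diff_def power_int_diff power_int_minus field_simps)
  also have "\<dots> = z a / z 0" using a(1) by (simp add: prod_dividef)
  finally show ?thesis using z[of 0] a(1) by (simp add: field_simps)
qed

text \<open>If the edges \<open>\<iota> 0, \<dots>, \<iota> (n - 1)\<close> generate the lattice, then the composite of the parametrization
  of \<open>X\<close> with the projection to these coordinates is injective on the torus, hence both are bijective.\<close>

lemma projection_bij:
  fixes f :: "nat \<Rightarrow> nat set"
  assumes sub: "\<And>i. i < s \<Longrightarrow> f i \<subseteq> {..<n}" and k: "\<And>i. i < s \<Longrightarrow> card (f i) = k" "k > 0"
    and n: "n \<ge> 1" and \<iota>: "\<And>j. j < n \<Longrightarrow> \<iota> j < s"
    and unim: "\<And>a. a < n \<Longrightarrow> unit_diff a \<in> zspan n (edge_vec f) (\<iota> ` {..<n})"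
  shows "bij_betw (\<lambda>P. normalize_pt (\<lambda>j. if j < n then P (\<iota> j) else 0))
    (clutter_pts n s f :: (nat \<Rightarrow> 'a::{finite,field}) set) (torus_pts n)"
proof -
  define \<phi> where "\<phi> x = normalize_pt (\<lambda>i. if i < s then (\<Prod>j\<in>f i. x j) else 0)" for x :: "nat \<Rightarrow> 'a"
  define \<pi> where "\<pi> P = normalize_pt (\<lambda>j. if j < n then P (\<iota> j) else 0)" for P :: "nat \<Rightarrow> 'a"
  let ?X = "clutter_pts n s f :: (nat \<Rightarrow> 'a) set" and ?T = "torus_pts n :: (nat \<Rightarrow> 'a) set"
  have s0: "0 < s" using \<iota>[of 0] n by simp
  have prod_ne: "(\<Prod>j\<in>f i. x j) \<noteq> 0" if "i < s" "\<And>j. j < n \<Longrightarrow> x j \<noteq> 0" for i and x :: "nat \<Rightarrow> 'a"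
    using sub[OF that(1)] that(2) finite_subset[OF sub[OF that(1)]] by auto
  \<comment> \<open>Normalising \<open>x\<close> first loses nothing: it divides every edge product
    by the same \<open>x 0 ^ k\<close>.\<close>
  have X: "?X = \<phi> ` ?T"
  proof
    show "\<phi> ` ?T \<subseteq> ?X"
    proof
      fix y assume "y \<in> \<phi> ` ?T"
      then obtain x where "y = \<phi> x" "x \<in> ?T" by blast
      then show "y \<in> ?X" using n unfolding clutter_pts_def \<phi>_def torus_pts_eq[OF n] by blast
    qed
    show "?X \<subseteq> \<phi> ` ?T"
    proof
      fix y assume "y \<in> ?X"
      then obtain x where y: "y = \<phi> x" and x: "\<forall>j<n. x j \<noteq> 0" "\<forall>j\<ge>n. x j = 0"
        unfolding clutter_pts_def \<phi>_def by blast
      have "\<phi> (normalize_pt x) = \<phi> x"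
      proof
        fix i
        have P: "(\<Prod>j\<in>f i. x j / x 0) = (\<Prod>j\<in>f i. x j) / x 0 ^ k" if "i < s" for i
          using k(1)[OF that] by (simp add: prod_dividef)
        have "x 0 \<noteq> 0" using x n by simp
        then show "\<phi> (normalize_pt x) i = \<phi> x i"
          using P s0 by (simp add: \<phi>_def normalize_pt_def)
      qed
      moreover have "normalize_pt x \<in> ?T" unfolding torus_pts_def using x by blast
      ultimately show "y \<in> \<phi> ` ?T" using y by (metis imageI)
    qed
  qed
  have Pne: "\<phi> x i \<noteq> 0" if "x \<in> ?T" "i < s" for x i
    using that prod_ne s0 n by (simp add: \<phi>_def normalize_pt_def torus_pts_eq)
  have T: "\<pi> (\<phi> x) \<in> ?T" if "x \<in> ?T" for x
    using Pne[OF that] \<iota> n by (auto simp: \<pi>_def normalize_pt_def torus_pts_eq)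
  have "inj_on (\<pi> \<circ> \<phi>) ?T"
  proof (rule inj_onI)
    fix x y assume x: "x \<in> ?T" and y: "y \<in> ?T" and eq: "(\<pi> \<circ> \<phi>) x = (\<pi> \<circ> \<phi>) y"
    have xy: "x j \<noteq> 0" "y j \<noteq> 0" if "j < n" for j using that x y n by (auto simp: torus_pts_eq)
    have pt: "(\<pi> \<circ> \<phi>) w j = (\<Prod>m\<in>f (\<iota> j). w m) / (\<Prod>m\<in>f (\<iota> 0). w m)"
      if w: "w \<in> ?T" and j: "j < n" for w j
    proof -
      have "(\<Prod>m\<in>f 0. w m) \<noteq> 0" using prod_ne[OF s0] w n by (simp add: torus_pts_eq)
      then show ?thesis using j n \<iota> s0 by (simp add: \<pi>_def \<phi>_def normalize_pt_def)
    qed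
    \<comment> \<open>The quotient reduces injectivity to a kernel: the chosen edge products of
      \<open>z\<close> all equal \<open>l\<close>, so \<open>z\<close> is constant, and its
      coordinate 0 is 1.\<close>
    define z where "z j = x j / y j" for j
    define l where "l = (\<Prod>m\<in>f (\<iota> 0). z m)"
    have l: "l \<noteq> 0" unfolding l_def using xy \<iota>[of 0] n by (intro prod_ne) (auto simp: z_def)
    have const: "(\<Prod>m\<in>f i. z m) = l" if "i \<in> \<iota> ` {..<n}" for i
    proof -
      obtain j where j: "i = \<iota> j" "j < n" using \<open>i \<in> \<iota> ` {..<n}\<close> by blast
      have ne: "(\<Prod>m\<in>f (\<iota> j). y m) \<noteq> 0" "(\<Prod>m\<in>f (\<iota> 0). y m) \<noteq> 0" "(\<Prod>m\<in>f (\<iota> 0). x m) \<noteq> 0"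
        using prod_ne xy \<iota> j n by auto
      have "(\<Prod>m\<in>f (\<iota> j). x m) / (\<Prod>m\<in>f (\<iota> 0). x m) = (\<Prod>m\<in>f (\<iota> j). y m) / (\<Prod>m\<in>f (\<iota> 0). y m)"
        using pt[OF x j(2)] pt[OF y j(2)] eq by simp
      then show ?thesis using ne by (simp add: l_def z_def j prod_dividef field_simps)
    qed
    have z1: "z a = 1" if "a < n" for a
    proof -
      have "z a = z 0"
        by (rule coordinates_eq_if_products_const[where B = "\<iota> ` {..<n}" and f = f and l = l and n = n and k = k])
          (use xy sub \<iota> k const l that unim in \<open>auto simp: z_def\<close>)
      then show ?thesis using x y n by (simp add: z_def torus_pts_eq)
    qed
    show "x = y"
    proof
      fix j
      show "x j = y j"
      proof (cases "j < n")
        case True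
        with z1 xy show ?thesis by (fastforce simp: z_def)
      next
        case False
        with x y n show ?thesis by (simp add: torus_pts_eq)
      qed
    qed
  qed
  moreover have "(\<pi> \<circ> \<phi>) ` ?T \<subseteq> ?T" using T by auto
  \<comment> \<open>An injective self-map of a finite set is onto. As \<open>\<phi>\<close> maps
    onto X, injectivity of the composite also makes \<open>\<pi>\<close> injective on X.\<close>
  ultimately have surj: "(\<pi> \<circ> \<phi>) ` ?T = ?T"
    using finite_torus_pts[OF n, where 'a = 'a] by (intro endo_inj_surj) auto
  from \<open>inj_on (\<pi> \<circ> \<phi>) ?T\<close> have "inj_on \<pi> ?X" unfolding X by (rule inj_on_imageI)
  moreover have "\<pi> ` ?X = ?T" using surj unfolding X by (simp add: image_comp)
  ultimately show ?thesis unfolding bij_betw_def \<pi>_def by blast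
qed

text \<open>Rename variable \<open>j\<close> to \<open>\<iota> j\<close>; \<open>b a\<close> pushes
  exponents forward, adding over fibres because \<open>\<iota>\<close> may repeat an index.\<close>

lemma form_pullback:
  assumes \<iota>: "\<And>j. j < n \<Longrightarrow> \<iota> j < s"
  shows "\<exists>G\<in>hpolys s d. \<forall>P. heval s d G P = heval n d c (\<lambda>j. P (\<iota> j))"
proof -
  define b where "b a i = (\<Sum>j | j < n \<and> \<iota> j = i. a j)" for a :: "nat \<Rightarrow> nat" and i
  have b: "b a \<in> mons s d" if "a \<in> mons n d" for a
  proof -
    have "(\<Sum>i<s. b a i) = (\<Sum>j<n. a j)"
      using sum.group[of "{..<n}" "{..<s}" \<iota> a] \<iota> by (auto simp: b_def)
    moreover have "b a i = 0" if "i \<ge> s" for i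
      unfolding b_def using \<iota> that by (intro sum.neutral) fastforce
    ultimately show ?thesis using \<open>a \<in> mons n d\<close> by (simp add: mons_def)
  qed
  have mono: "(\<Prod>i<s. P i ^ b a i) = (\<Prod>j<n. P (\<iota> j) ^ a j)" for P a
  proof -
    have "(\<Prod>i<s. P i ^ b a i) = (\<Prod>i<s. \<Prod>j | j \<in> {..<n} \<and> \<iota> j = i. P (\<iota> j) ^ a j)"
      unfolding b_def power_sum by (intro prod.cong) auto
    also have "\<dots> = (\<Prod>j<n. P (\<iota> j) ^ a j)" using \<iota> by (intro prod.group) auto
    finally show ?thesis .
  qed
  from monomial_sum_is_form[OF finite_mons b, of n d "\<lambda>a. a" c]
  show ?thesis by (simp add: mono heval_def)
qed

section \<open>Comparison of X with the torus\<close>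

theorem theorem5p1:
  fixes n s :: nat and f :: "nat \<Rightarrow> nat set"
  assumes q: "card (UNIV :: 'a set) \<noteq> 2"
    and s2: "s \<ge> 2"
    and clutter: "is_clutter n s f"
    and unif: "uniform_clutter s f"
    and rank: "incidence_rank s f = n"
    and normal: "normal_edge_ideal n s f"
  shows "(deg_quot s (clutter_pts n s f :: (nat \<Rightarrow> 'a::{finite,field}) set) = card (clutter_pts n s f :: (nat \<Rightarrow> 'a) set)
         \<and> card (clutter_pts n s f :: (nat \<Rightarrow> 'a) set) = (card (UNIV :: 'a set) - 1) ^ (n - 1))
    \<and> (\<forall>d\<ge>1. min_dist s d (clutter_pts n s f :: (nat \<Rightarrow> 'a) set) \<le> min_dist n d (torus_pts n :: (nat \<Rightarrow> 'a) set))
    \<and> (reg_quot s (clutter_pts n s f :: (nat \<Rightarrow> 'a) set) \<le> reg_quot n (torus_pts n :: (nat \<Rightarrow> 'a) set)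
         \<and> reg_quot n (torus_pts n :: (nat \<Rightarrow> 'a) set) = (card (UNIV :: 'a set) - 2) * (n - 1))"
proof -
  let ?X = "clutter_pts n s f :: (nat \<Rightarrow> 'a) set" and ?T = "torus_pts n :: (nat \<Rightarrow> 'a) set"
  let ?p = "(card (UNIV :: 'a set) - 2) * (n - 1)"
  define k where "k = card (f 0)"
  have sub: "f i \<subseteq> {..<n}" if "i < s" for i using clutter that by (simp add: is_clutter_def)
  have k: "card (f i) = k" if "i < s" for i
    using unif that s2 unfolding uniform_clutter_def k_def by (meson less_le_trans pos2)
  \<comment> \<open>Two incomparable edges are nonempty and need at least two vertices; this yields
    \<open>k > 0\<close> and \<open>n \<ge> 2\<close>.\<close>
  have incomp: "\<not> f 0 \<subseteq> f 1" "\<not> f 1 \<subseteq> f 0"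
    using clutter s2 unfolding is_clutter_def by (auto simp: numeral_2_eq_2)
  have k0: "k > 0"
    using incomp finite_subset[OF sub[of 0]] s2 by (auto simp: k_def card_gt_0_iff)
  have n2: "n \<ge> 2"
  proof (rule ccontr)
    assume "\<not> n \<ge> 2"
    then have "f i \<subseteq> {0}" if "i < s" for i using sub[OF that] by auto
    then have "f 0 \<subseteq> {0}" "f 1 \<subseteq> {0}" using s2 by auto
    with incomp show False by blast
  qed
  then have n1: "n \<ge> 1" by simp
  obtain \<iota> where \<iota>: "\<And>j. j < n \<Longrightarrow> \<iota> j < s"
    "\<And>a. a < n \<Longrightarrow> unit_diff a \<in> zspan n (edge_vec f) (\<iota> ` {..<n})"
    using unimodular_edges_exist[OF sub k k0 rank normal n2] by blast
  define \<pi> where "\<pi> P = normalize_pt (\<lambda>j. if j < n then P (\<iota> j) else 0)" for P :: "nat \<Rightarrow> 'a"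
  have bij: "bij_betw \<pi> ?X ?T"
    unfolding \<pi>_def using projection_bij[OF sub k k0 n1 \<iota>] by blast
  have finT: "finite ?T" by (rule finite_torus_pts[OF n1])
  then have finX: "finite ?X" using bij_betw_finite[OF bij] by blast
  have cardX: "card ?X = card ?T" by (rule bij_betw_same_card[OF bij])
  have Xne: "P i \<noteq> 0" if "P \<in> ?X" "i < s" for P i
  proof -
    have s0: "0 < s" using s2 by simp
    obtain x where P: "P = normalize_pt (\<lambda>i. if i < s then (\<Prod>j\<in>f i. x j) else 0)"
      and x: "\<forall>j<n. x j \<noteq> 0" using \<open>P \<in> ?X\<close> unfolding clutter_pts_def by blast
    have "(\<Prod>j\<in>f i. x j) \<noteq> 0" if "i < s" for i
      using sub[OF that] x finite_subset[OF sub[OF that]] by auto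
    with P \<open>i < s\<close> s0 show ?thesis by (simp add: normalize_pt_def)
  qed
  \<comment> \<open>The factor \<open>P (\<iota> 0) ^ d\<close> undoes the normalisation in
    \<open>\<pi>\<close>; being nonzero, it preserves supports.\<close>
  have pull: "\<exists>G\<in>hpolys s d. \<forall>P\<in>?X. heval s d G P = P (\<iota> 0) ^ d * heval n d c (\<pi> P)" for d c
  proof -
    obtain G where G: "G \<in> hpolys s d" "\<And>P. heval s d G P = heval n d c (\<lambda>j. P (\<iota> j))"
      using form_pullback[of n \<iota> s d c] \<iota>(1) by blast
    have "heval n d c (\<lambda>j. P (\<iota> j)) = P (\<iota> 0) ^ d * heval n d c (\<pi> P)" if "P \<in> ?X" for P
    proof -
      have "P (\<iota> 0) \<noteq> 0" using Xne[OF that] \<iota>(1) n1 by simp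
      then have "heval n d c (\<lambda>j. P (\<iota> j)) = heval n d c (\<lambda>j. P (\<iota> 0) * \<pi> P j)"
        using n1 by (intro heval_cong) (simp add: \<pi>_def normalize_pt_def)
      then show ?thesis by (simp only: heval_homogeneous)
    qed
    with G(2) have "\<forall>P\<in>?X. heval s d G P = P (\<iota> 0) ^ d * heval n d c (\<pi> P)" by simp
    with G(1) show ?thesis by blast
  qed
  have \<iota>0: "P (\<iota> 0) \<noteq> 0" if "P \<in> ?X" for P using Xne[OF that] \<iota>(1) n1 by simp
  have hilb_le: "hilb n ?T d \<le> hilb s ?X d" for d
  proof -
    define \<Psi> where "\<Psi> e P = (if P \<in> ?X then P (\<iota> 0) ^ d * e (\<pi> P) else 0)" for e :: "(nat \<Rightarrow> 'a) \<Rightarrow> 'a" and P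
    have "inj_on \<Psi> (evals n d ?T)"
    proof (rule inj_onI)
      fix e e' assume e: "e \<in> evals n d ?T" "e' \<in> evals n d ?T" and eq: "\<Psi> e = \<Psi> e'"
      show "e = e'"
      proof
        fix Q
        show "e Q = e' Q"
        proof (cases "Q \<in> ?T")
          case True
          then obtain P where P: "P \<in> ?X" "Q = \<pi> P" using bij_betw_imp_surj_on[OF bij] by blast
          then show ?thesis using fun_cong[OF eq, of P] \<iota>0[OF P(1)] by (simp add: \<Psi>_def)
        next
          case False
          then have "e Q = 0" "e' Q = 0"
            using e[THEN subsetD[OF evals_subset_supported]] by (simp_all add: supported_def)
          then show ?thesis by simp
        qed
      qed
    qed
    moreover have "\<Psi> ` evals n d ?T \<subseteq> evals s d ?X"
    proof (rule image_subsetI)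
      fix e assume "e \<in> evals n d ?T"
      then obtain c where e: "e = (\<lambda>P. if P \<in> ?T then heval n d c P else 0)" by (auto simp: evals_def)
      obtain G where G: "G \<in> hpolys s d" "\<And>P. P \<in> ?X \<Longrightarrow> heval s d G P = P (\<iota> 0) ^ d * heval n d c (\<pi> P)"
        using pull[of d c] by blast
      have "\<Psi> e = (\<lambda>P. if P \<in> ?X then heval s d G P else 0)"
        using G(2) bij_betwE[OF bij] by (auto simp: \<Psi>_def e fun_eq_iff)
      with G(1) show "\<Psi> e \<in> evals s d ?X" unfolding evals_def by blast
    qed
    moreover have "finite (evals s d ?X)"
      using finite_subset[OF evals_subset_supported finite_supported[OF finX]] .
    ultimately have "card (evals n d ?T) \<le> card (evals s d ?X)" by (rule card_inj_on_le)
    then show ?thesis unfolding card_evals using card_field_gt_1[where 'a = 'a] by simp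
  qed
  have hilbT: "hilb n ?T d = card ?T" if "d \<ge> ?p" for d
    using hilb_eq_card_iff[OF finT] evals_torus_full[OF n1 that] by simp
  \<comment> \<open>Squeezed between \<open>hilb n ?T d = card ?T\<close> and
    \<open>card ?X = card ?T\<close>.\<close>
  have hilbX: "hilb s ?X d = card ?X" if "d \<ge> ?p" for d
    using hilb_le[of d] hilbT[OF that] hilb_le_card[OF finX, of s d] cardX by simp
  have "deg_quot s ?X = card ?X"
    unfolding deg_quot_def
  proof (rule the_equality)
    show "\<exists>d0. \<forall>d\<ge>d0. hilb s ?X d = card ?X" using hilbX by blast
    fix m assume "\<exists>d0. \<forall>d\<ge>d0. hilb s ?X d = m"
    then obtain d0 where "\<forall>d\<ge>d0. hilb s ?X d = m" by blast
    then show "m = card ?X" using hilbX[of "max d0 ?p"] by (metis max.cobounded1 max.cobounded2)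
  qed
  moreover have "card ?X = (card (UNIV :: 'a set) - 1) ^ (n - 1)"
    using cardX card_torus_pts[OF n1, where 'a = 'a] by simp
  \<comment> \<open>Every nonzero weight of the torus code occurs in the code of X, so the minimum
    for X is taken over a larger set.\<close>
  moreover have "min_dist s d ?X \<le> min_dist n d ?T" for d
    unfolding min_dist_def
  proof (rule Min_antimono)
    let ?wX = "{card {P\<in>?X. code_entry s d c P \<noteq> 0} | c. c \<in> hpolys s d \<and> (\<exists>P\<in>?X. code_entry s d c P \<noteq> 0)}"
    let ?wT = "{card {P\<in>?T. code_entry n d c P \<noteq> 0} | c. c \<in> hpolys n d \<and> (\<exists>P\<in>?T. code_entry n d c P \<noteq> 0)}"
    have entX: "code_entry s d c P \<noteq> 0 \<longleftrightarrow> heval s d c P \<noteq> 0" if "P \<in> ?X" for c P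
      using Xne[OF that, of 0] s2 by (simp add: code_entry_def)
    have entT: "code_entry n d c P \<noteq> 0 \<longleftrightarrow> heval n d c P \<noteq> 0" if "P \<in> ?T" for c P
      using that n1 by (simp add: code_entry_def torus_pts_eq)
    show "finite ?wX"
      by (rule finite_subset[of _ "{..card ?X}"]) (auto intro!: card_mono finX)
    show "?wT \<noteq> {}"
    proof -
      define P where "P = (\<lambda>j. if j < n then 1 else 0 :: 'a)"
      \<comment> \<open>The exponent of the \<open>d\<close>-th power of the first variable, a form
        with value 1 at \<open>P\<close>.\<close>
      define a :: "nat \<Rightarrow> nat" where "a = (\<lambda>j. if j = 0 then d else 0)"
      have P: "P \<in> ?T" using n1 by (simp add: torus_pts_eq P_def)
      have "a \<in> mons n d" using n1 by (simp add: a_def mons_def)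
      then obtain c where c: "c \<in> hpolys n d" "\<And>P. heval n d c P = (\<Sum>k\<in>{a}. (1::'a) * (\<Prod>j<n. P j ^ k j))"
        using monomial_sum_is_form[of "{a}" "\<lambda>a. a" n d "\<lambda>_. 1"] by auto
      have "heval n d c P \<noteq> 0" using c(2) by (simp add: P_def)
      then have "code_entry n d c P \<noteq> 0" using entT[OF P] by simp
      with P c(1) show ?thesis by blast
    qed
    show "?wT \<subseteq> ?wX"
    proof
      fix w assume "w \<in> ?wT"
      then obtain c Q where w: "w = card {P\<in>?T. code_entry n d c P \<noteq> 0}"
        and Q: "Q \<in> ?T" "code_entry n d c Q \<noteq> 0" by blast
      obtain G where G: "G \<in> hpolys s d" "\<And>P. P \<in> ?X \<Longrightarrow> heval s d G P = P (\<iota> 0) ^ d * heval n d c (\<pi> P)"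
        using pull[of d c] by blast
      have iff: "code_entry s d G P \<noteq> 0 \<longleftrightarrow> code_entry n d c (\<pi> P) \<noteq> 0" if "P \<in> ?X" for P
        using entX[OF that] entT[of "\<pi> P"] bij_betwE[OF bij] that G(2)[OF that] \<iota>0[OF that] by simp
      from Q(1) have "Q \<in> \<pi> ` ?X" unfolding bij_betw_imp_surj_on[OF bij] .
      then obtain R where R: "R \<in> ?X" "\<pi> R = Q" by blast
      have "bij_betw \<pi> {P\<in>?X. code_entry s d G P \<noteq> 0} {P\<in>?T. code_entry n d c P \<noteq> 0}"
      proof (rule bij_betw_subset[OF bij])
        show "\<pi> ` {P\<in>?X. code_entry s d G P \<noteq> 0} = {P\<in>?T. code_entry n d c P \<noteq> 0}"
          unfolding bij_betw_imp_surj_on[OF bij, symmetric] using iff by blast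
      qed auto
      then have "card {P\<in>?X. code_entry s d G P \<noteq> 0} = w" unfolding w by (rule bij_betw_same_card)
      moreover have "code_entry s d G R \<noteq> 0" using iff[OF R(1)] R(2) Q(2) by simp
      ultimately show "w \<in> ?wX" using G(1) R(1) by blast
    qed
  qed
  moreover have "reg_quot n ?T = ?p" by (rule reg_quot_torus_pts[OF n1])
  moreover have "reg_quot s ?X \<le> ?p"
    unfolding reg_quot_def by (rule Least_le) (use hilbX in blast)
  ultimately show ?thesis by simp
qed

end
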